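(* Let $G$ be a topological group. Then the algebra $Asp(G)$ of Asplund functions on $G$ is left amenable; that is, there is a left invariant mean on $Asp(G)$.
   Context: A compact $G$-system here is a compact Hausdorff space $X$ with a jointly continuous action $G\times X\to X$ of the topological group $G$ (the identity of $G$ acting as the identity map). Let $\mu$ be the unique compatible uniform structure of $X$. $X$ is nonsensitive if for every $\varepsilon\in\mu$ there is a nonempty open $O\subset X$ such that $gO\times gO\subset\varepsilon$ for all $g\in G$; $X$ is hereditarily nonsensitive (HNS) if every nonempty closed $G$-invariant subset of $X$ is a nonsensitive $G$-system. A continuous bounded function $f:G\to\mathbb{R}$ is an Asplund function if there are a HNS compact $G$-system $X$, a continuous $F:X\to\mathbb{R}$ and a point $x_0\in X$ with $f(g)=F(gx_0)$ for all $g\in G$. $Asp(G)$ is the set of all Asplund functions; it is a uniformly closed $G$-invariant subalgebra of $\ell_\infty(G)$ (containing the constants). A mean on a left translation invariant subspace $F\subset\ell_\infty(G)$ containing the constants is a linear functional $m$ on $F$ with $m(1)=1=\|m\|$; it is left invariant if $m(L_gf)=m(f)$ for all $g\in G$, $f\in F$, where $(L_gf)(h)=f(gh)$. $F$ is left amenable if the affine compact $G$-system $M(F)$ of means on $F$ (weak$^*$ topology) has a fixed point, i.e. if $F$ has a left invariant mean. *)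

theory Defs
  imports "HOL-Analysis.Analysis"
begin

text \<open>
  A topological group is a type of class \<^class>\<open>topological_group_add\<close>. This class is not
  commutative; its operation is merely written additively, so \<open>g + h\<close> is the product \<open>gh\<close>
  and \<open>0\<close> is the identity of the group.
\<close>

subsection \<open>Compact systems\<close>

definition compact_system ::
    "'x topology \<Rightarrow> ('g::topological_group_add \<Rightarrow> 'x \<Rightarrow> 'x) \<Rightarrow> bool" where
  "compact_system X act \<longleftrightarrow>
     compact_space X \<and> Hausdorff_space X \<and>
     continuous_map (prod_topology euclidean X) X (\<lambda>(g, x). act g x) \<and>
     (\<forall>x\<in>topspace X. act 0 x = x) \<and>
     (\<forall>g h. \<forall>x\<in>topspace X. act (g + h) x = act g (act h x))"

definition invariant_set :: "('g \<Rightarrow> 'x \<Rightarrow> 'x) \<Rightarrow> 'x set \<Rightarrow> bool" where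
  "invariant_set act Y \<longleftrightarrow> (\<forall>g. \<forall>y\<in>Y. act g y \<in> Y)"


subsection \<open>The uniform structure of a compact Hausdorff space\<close>

definition uniform_structure :: "'x set \<Rightarrow> ('x \<times> 'x) set set \<Rightarrow> bool" where
  "uniform_structure S U \<longleftrightarrow>
     U \<noteq> {} \<and>
     (\<forall>E\<in>U. E \<subseteq> S \<times> S \<and> Id_on S \<subseteq> E \<and> E\<inverse> \<in> U \<and> (\<exists>D\<in>U. D O D \<subseteq> E)) \<and>
     (\<forall>E\<in>U. \<forall>D\<in>U. E \<inter> D \<in> U) \<and>
     (\<forall>E\<in>U. \<forall>D. E \<subseteq> D \<and> D \<subseteq> S \<times> S \<longrightarrow> D \<in> U)"

definition compatible_uniformity :: "'x topology \<Rightarrow> ('x \<times> 'x) set set \<Rightarrow> bool" where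
  "compatible_uniformity X U \<longleftrightarrow>
     uniform_structure (topspace X) U \<and>
     (\<forall>V. openin X V \<longleftrightarrow> V \<subseteq> topspace X \<and> (\<forall>x\<in>V. \<exists>E\<in>U. E `` {x} \<subseteq> V))"

text \<open>
  Meaningful for compact Hausdorff \<open>X\<close>, where exactly one compatible uniform structure exists:
  see \<open>ex1_compatible_uniformity\<close> below.
\<close>

definition the_uniformity :: "'x topology \<Rightarrow> ('x \<times> 'x) set set" where
  "the_uniformity X = (THE U. compatible_uniformity X U)"


subsection \<open>Nonsensitivity and Asplund functions\<close>

definition nonsensitive :: "'x topology \<Rightarrow> ('g \<Rightarrow> 'x \<Rightarrow> 'x) \<Rightarrow> bool" where
  "nonsensitive X act \<longleftrightarrow>
     (\<forall>E\<in>the_uniformity X. \<exists>V. openin X V \<and> V \<noteq> {} \<and> (\<forall>g. (act g ` V) \<times> (act g ` V) \<subseteq> E))"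

definition HNS :: "'x topology \<Rightarrow> ('g \<Rightarrow> 'x \<Rightarrow> 'x) \<Rightarrow> bool" where
  "HNS X act \<longleftrightarrow>
     (\<forall>Y. closedin X Y \<and> Y \<noteq> {} \<and> invariant_set act Y \<longrightarrow> nonsensitive (subtopology X Y) act)"

text \<open>
  HOL cannot quantify over all types inside a formula, so the phase space \<open>X\<close> is taken to be
  carried by a subset of the type of sets of subsets of the group. This loses no systems: the
  closure of the orbit of \<open>x\<^sub>0\<close> is again a hereditarily nonsensitive system, and it is a
  Hausdorff space with a dense image of the group, hence embeds into that type. The lemma
  \<open>Asp_I\<close> below shows that systems on an arbitrary type yield the same functions.
\<close>

definition Asp :: "('g::topological_group_add \<Rightarrow> real) set" where
  "Asp = {f. continuous_on UNIV f \<and> bounded (range f) \<and>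
     (\<exists>(X :: 'g set set topology) act F x\<^sub>0.
        compact_system X act \<and> HNS X act \<and> continuous_map X euclideanreal F \<and>
        x\<^sub>0 \<in> topspace X \<and> (\<forall>g. f g = F (act g x\<^sub>0)))}"


subsection \<open>Means\<close>

definition left_translate :: "'g::plus \<Rightarrow> ('g \<Rightarrow> real) \<Rightarrow> 'g \<Rightarrow> real" where
  "left_translate g f = (\<lambda>h. f (g + h))"

definition invariant_subspace :: "('g::plus \<Rightarrow> real) set \<Rightarrow> bool" where
  "invariant_subspace F \<longleftrightarrow>
     (\<forall>f\<in>F. bounded (range f)) \<and>
     (\<forall>c. (\<lambda>_. c) \<in> F) \<and>
     (\<forall>f\<in>F. \<forall>h\<in>F. (\<lambda>x. f x + h x) \<in> F) \<and>
     (\<forall>c. \<forall>f\<in>F. (\<lambda>x. c * f x) \<in> F) \<and>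
     (\<forall>g. \<forall>f\<in>F. left_translate g f \<in> F)"

definition sup_norm :: "('g \<Rightarrow> real) \<Rightarrow> real" where
  "sup_norm f = (SUP x. \<bar>f x\<bar>)"

text \<open>The norm is extended-real valued, so that an unbounded functional has norm \<open>\<infinity>\<close>.\<close>

definition functional_norm :: "('g \<Rightarrow> real) set \<Rightarrow> (('g \<Rightarrow> real) \<Rightarrow> real) \<Rightarrow> ereal" where
  "functional_norm F m = (SUP f\<in>{f\<in>F. sup_norm f \<le> 1}. ereal \<bar>m f\<bar>)"

definition mean_on :: "('g \<Rightarrow> real) set \<Rightarrow> (('g \<Rightarrow> real) \<Rightarrow> real) \<Rightarrow> bool" where
  "mean_on F m \<longleftrightarrow>
     (\<forall>f\<in>F. \<forall>h\<in>F. m (\<lambda>x. f x + h x) = m f + m h) \<and>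
     (\<forall>c. \<forall>f\<in>F. m (\<lambda>x. c * f x) = c * m f) \<and>
     m (\<lambda>_. 1) = 1 \<and> functional_norm F m = 1"

definition left_invariant_on :: "('g::plus \<Rightarrow> real) set \<Rightarrow> (('g \<Rightarrow> real) \<Rightarrow> real) \<Rightarrow> bool" where
  "left_invariant_on F m \<longleftrightarrow> (\<forall>g. \<forall>f\<in>F. m (left_translate g f) = m f)"

definition left_amenable :: "('g::plus \<Rightarrow> real) set \<Rightarrow> bool" where
  "left_amenable F \<longleftrightarrow> invariant_subspace F \<and> (\<exists>m. mean_on F m \<and> left_invariant_on F m)"


subsection \<open>Uniqueness of the uniform structure\<close>

definition diagonal_neighbourhoods :: "'x topology \<Rightarrow> ('x \<times> 'x) set set" where
  "diagonal_neighbourhoods X = {E. E \<subseteq> topspace X \<times> topspace X \<and>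
     (\<exists>W. openin (prod_topology X X) W \<and> Id_on (topspace X) \<subseteq> W \<and> W \<subseteq> E)}"

lemma diagonal_neighbourhoodsI:
  assumes "openin (prod_topology X X) W" "Id_on (topspace X) \<subseteq> W" "W \<subseteq> E"
    "E \<subseteq> topspace X \<times> topspace X"
  shows "E \<in> diagonal_neighbourhoods X"
  using assms unfolding diagonal_neighbourhoods_def by (intro CollectI conjI exI[of _ W])

lemma diagonal_neighbourhoodsE:
  assumes "E \<in> diagonal_neighbourhoods X"
  obtains W where "openin (prod_topology X X) W" "Id_on (topspace X) \<subseteq> W" "W \<subseteq> E"
    "E \<subseteq> topspace X \<times> topspace X"
  using assms unfolding diagonal_neighbourhoods_def by blast

lemma compact_space_pointwise_cover:
  assumes "compact_space X" "\<And>x. x \<in> topspace X \<Longrightarrow> openin X (A x) \<and> x \<in> A x"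
  obtains T where "finite T" "T \<subseteq> topspace X" "topspace X \<subseteq> \<Union>(A ` T)"
proof -
  have "\<forall>U\<in>A ` topspace X. openin X U" "topspace X \<subseteq> \<Union>(A ` topspace X)"
    using assms(2) by auto
  then obtain F where F: "finite F" "F \<subseteq> A ` topspace X" "topspace X \<subseteq> \<Union>F"
    using assms(1) unfolding compact_space_alt by meson
  then obtain T where "T \<subseteq> topspace X" "finite T" "F = A ` T"
    using finite_subset_image[OF F(1,2)] by auto
  then show ?thesis using that F by blast
qed

lemma diagonal_neighbourhoods_comp:
  assumes "compact_space X" "Hausdorff_space X" "openin (prod_topology X X) W"
    "Id_on (topspace X) \<subseteq> W"
  obtains V where "openin (prod_topology X X) V" "Id_on (topspace X) \<subseteq> V" "V O V \<subseteq> W"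
proof -
  let ?S = "topspace X"
  have reg: "regular_space X"
    using assms compact_Hausdorff_imp_regular_space by blast
  have "\<exists>A C P. openin X A \<and> closedin X C \<and> openin X P \<and> x \<in> A \<and> A \<subseteq> C \<and> C \<subseteq> P \<and> P \<times> P \<subseteq> W"
    if x: "x \<in> ?S" for x
  proof -
    have "(x, x) \<in> W" using x assms(4) by auto
    then obtain P Q where PQ: "openin X P" "openin X Q" "x \<in> P" "x \<in> Q" "P \<times> Q \<subseteq> W"
      using assms(3) unfolding openin_prod_topology_alt by metis
    have "openin X (P \<inter> Q)" "x \<in> P \<inter> Q" using PQ by auto
    then obtain A C where "openin X A" "closedin X C" "x \<in> A" "A \<subseteq> C" "C \<subseteq> P \<inter> Q"
      using reg unfolding neighbourhood_base_of_closedin[symmetric] neighbourhood_base_of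
      by metis
    moreover have "(P \<inter> Q) \<times> (P \<inter> Q) \<subseteq> W" using PQ by blast
    ultimately show ?thesis using \<open>openin X (P \<inter> Q)\<close> by blast
  qed
  then obtain A C P where ACP: "\<And>x. x \<in> ?S \<Longrightarrow> openin X (A x) \<and> closedin X (C x) \<and>
      openin X (P x) \<and> x \<in> A x \<and> A x \<subseteq> C x \<and> C x \<subseteq> P x \<and> P x \<times> P x \<subseteq> W"
    by metis
  obtain T where T: "finite T" "T \<subseteq> ?S" "?S \<subseteq> \<Union>(A ` T)"
    by (rule compact_space_pointwise_cover[OF assms(1), of A]) (use ACP in auto)
  define V where "V = (?S \<times> ?S) \<inter> (\<Inter>x\<in>T. P x \<times> P x \<union> (?S - C x) \<times> (?S - C x))"
  have op: "openin (prod_topology X X) (P x \<times> P x \<union> (?S - C x) \<times> (?S - C x))" if "x \<in> T" for x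
  proof -
    have "openin X (P x)" "openin X (?S - C x)" using ACP[of x] that T by blast+
    then show ?thesis by (intro openin_Un) (simp_all add: openin_prod_Times_iff)
  qed
  have "openin (prod_topology X X) V"
  proof (cases "T = {}")
    case True
    then show ?thesis by (simp add: V_def openin_prod_Times_iff)
  next
    case False
    have "openin (prod_topology X X) (?S \<times> ?S)"
      by (simp add: openin_prod_Times_iff)
    moreover have "openin (prod_topology X X) (\<Inter>x\<in>T. P x \<times> P x \<union> (?S - C x) \<times> (?S - C x))"
      using op T False by (intro openin_Inter) auto
    ultimately show ?thesis unfolding V_def by (rule openin_Int)
  qed
  moreover have "Id_on ?S \<subseteq> V"
    using ACP T unfolding V_def by blast
  moreover have "V O V \<subseteq> W"
  proof clarify
    fix a b c assume ab: "(a, b) \<in> V" and bc: "(b, c) \<in> V"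
    then have "b \<in> ?S" unfolding V_def by auto
    then obtain x where x: "x \<in> T" "b \<in> A x" using T by blast
    then have "b \<in> C x" using ACP T by blast
    then have "a \<in> P x" "c \<in> P x" using ab bc x unfolding V_def by auto
    then show "(a, c) \<in> W" using ACP[of x] x T by blast
  qed
  ultimately show ?thesis using that by blast
qed

lemma diagonal_neighbourhoods_compatible:
  assumes "compact_space X" "Hausdorff_space X"
  shows "compatible_uniformity X (diagonal_neighbourhoods X)"
proof -
  let ?S = "topspace X" and ?N = "diagonal_neighbourhoods X" and ?XX = "prod_topology X X"
  have top: "?S \<times> ?S \<in> ?N"
  proof -
    have "openin ?XX (?S \<times> ?S)" by (simp add: openin_prod_Times_iff)
    then show ?thesis unfolding diagonal_neighbourhoods_def by blast
  qed
  have conv: "E\<inverse> \<in> ?N" if E: "E \<in> ?N" for E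
  proof -
    obtain W where W: "openin ?XX W" "Id_on ?S \<subseteq> W" "W \<subseteq> E" "E \<subseteq> ?S \<times> ?S"
      using diagonal_neighbourhoodsE[OF E] by metis
    have "openin ?XX (W\<inverse>)"
      unfolding openin_prod_topology_alt
    proof (intro allI impI)
      fix x y assume "(x, y) \<in> W\<inverse>"
      then have "(y, x) \<in> W" by simp
      then obtain P Q where "openin X P" "openin X Q" "y \<in> P" "x \<in> Q" "P \<times> Q \<subseteq> W"
        using W(1) unfolding openin_prod_topology_alt by metis
      moreover from this have "Q \<times> P \<subseteq> W\<inverse>" by auto
      ultimately show "\<exists>Q P. openin X Q \<and> openin X P \<and> x \<in> Q \<and> y \<in> P \<and> Q \<times> P \<subseteq> W\<inverse>"
        by (intro exI conjI)
    qed
    moreover have "Id_on ?S \<subseteq> W\<inverse>" "W\<inverse> \<subseteq> E\<inverse>" "E\<inverse> \<subseteq> ?S \<times> ?S" using W by auto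
    ultimately show ?thesis by (rule diagonal_neighbourhoodsI)
  qed
  have comp: "\<exists>D\<in>?N. D O D \<subseteq> E" if E: "E \<in> ?N" for E
  proof -
    obtain W where W: "openin ?XX W" "Id_on ?S \<subseteq> W" "W \<subseteq> E" "E \<subseteq> ?S \<times> ?S"
      using diagonal_neighbourhoodsE[OF E] by metis
    obtain V where V: "openin ?XX V" "Id_on ?S \<subseteq> V" "V O V \<subseteq> W"
      using diagonal_neighbourhoods_comp[OF assms W(1,2)] by blast
    have "V \<subseteq> ?S \<times> ?S" using openin_subset[OF V(1)] by simp
    then have "V \<in> ?N" using V diagonal_neighbourhoodsI by blast
    then show ?thesis using V W by blast
  qed
  have int: "E \<inter> D \<in> ?N" if E: "E \<in> ?N" and D: "D \<in> ?N" for E D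
  proof -
    obtain W where W: "openin ?XX W" "Id_on ?S \<subseteq> W" "W \<subseteq> E" "E \<subseteq> ?S \<times> ?S"
      using diagonal_neighbourhoodsE[OF E] by metis
    obtain V where V: "openin ?XX V" "Id_on ?S \<subseteq> V" "V \<subseteq> D" "D \<subseteq> ?S \<times> ?S"
      using diagonal_neighbourhoodsE[OF D] by metis
    have "openin ?XX (W \<inter> V)" using W V by blast
    moreover have "Id_on ?S \<subseteq> W \<inter> V" "W \<inter> V \<subseteq> E \<inter> D" "E \<inter> D \<subseteq> ?S \<times> ?S"
      using W V by (simp_all add: le_infI1 le_infI2)
    ultimately show ?thesis by (rule diagonal_neighbourhoodsI)
  qed
  have us: "uniform_structure ?S ?N"
    unfolding uniform_structure_def
  proof (intro conjI ballI allI impI)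
    show "?N \<noteq> {}" using top by blast
  next
    fix E D assume "E \<in> ?N" and D: "E \<subseteq> D \<and> D \<subseteq> ?S \<times> ?S"
    then obtain W where W: "openin ?XX W" "Id_on ?S \<subseteq> W" "W \<subseteq> E"
      using diagonal_neighbourhoodsE by metis
    then have "W \<subseteq> D" using D by (meson order_trans)
    then show "D \<in> ?N" using D W diagonal_neighbourhoodsI by metis
  next
    fix E assume "E \<in> ?N"
    then obtain W where "Id_on ?S \<subseteq> W" "W \<subseteq> E" "E \<subseteq> ?S \<times> ?S"
      using diagonal_neighbourhoodsE by metis
    then show "E \<subseteq> ?S \<times> ?S" "Id_on ?S \<subseteq> E" by simp_all
  qed (use conv comp int in blast)+
  have "openin X V \<longleftrightarrow> V \<subseteq> ?S \<and> (\<forall>x\<in>V. \<exists>E\<in>?N. E `` {x} \<subseteq> V)" for V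
  proof
    assume V: "openin X V"
    have "\<exists>E\<in>?N. E `` {x} \<subseteq> V" if x: "x \<in> V" for x
    proof -
      let ?E = "V \<times> V \<union> (?S - {x}) \<times> (?S - {x})"
      have xS: "x \<in> ?S" using V x openin_subset by blast
      have "closedin X {x}"
        using assms(2) xS by (meson Hausdorff_imp_t1_space closedin_t1_singleton)
      then have "openin ?XX ?E"
        using V by (intro openin_Un) (auto simp: openin_prod_Times_iff)
      moreover have "Id_on ?S \<subseteq> ?E" using x by auto
      moreover have "?E \<subseteq> ?S \<times> ?S" using openin_subset[OF V] by blast
      ultimately have "?E \<in> ?N" unfolding diagonal_neighbourhoods_def by blast
      moreover have "?E `` {x} \<subseteq> V" by auto
      ultimately show ?thesis by blast
    qed
    then show "V \<subseteq> ?S \<and> (\<forall>x\<in>V. \<exists>E\<in>?N. E `` {x} \<subseteq> V)"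
      using openin_subset[OF V] by blast
  next
    assume V: "V \<subseteq> ?S \<and> (\<forall>x\<in>V. \<exists>E\<in>?N. E `` {x} \<subseteq> V)"
    show "openin X V"
    proof (subst openin_subopen, rule ballI)
      fix x assume x: "x \<in> V"
      then obtain E where E: "E \<in> ?N" "E `` {x} \<subseteq> V" using V by blast
      then obtain W where W: "openin ?XX W" "Id_on ?S \<subseteq> W" "W \<subseteq> E"
        unfolding diagonal_neighbourhoods_def by blast
      have "(x, x) \<in> W" using W x V by auto
      then obtain P Q where "openin X P" "openin X Q" "x \<in> P" "x \<in> Q" "P \<times> Q \<subseteq> W"
        using W(1) unfolding openin_prod_topology_alt by metis
      then have "openin X Q \<and> x \<in> Q \<and> Q \<subseteq> V" using W E by blast
      then show "\<exists>T. openin X T \<and> x \<in> T \<and> T \<subseteq> V" by blast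
    qed
  qed
  then show ?thesis using us unfolding compatible_uniformity_def by blast
qed

lemma compatible_uniformityD:
  assumes "compatible_uniformity X U"
  shows "\<And>E. E \<in> U \<Longrightarrow> E \<subseteq> topspace X \<times> topspace X \<and> Id_on (topspace X) \<subseteq> E \<and>
      E\<inverse> \<in> U \<and> (\<exists>D\<in>U. D O D \<subseteq> E)"
    and "\<And>E D. E \<in> U \<Longrightarrow> D \<in> U \<Longrightarrow> E \<inter> D \<in> U"
    and "\<And>E D. E \<in> U \<Longrightarrow> E \<subseteq> D \<Longrightarrow> D \<subseteq> topspace X \<times> topspace X \<Longrightarrow> D \<in> U"
    and "U \<noteq> {}"
    and "\<And>V. openin X V \<longleftrightarrow> V \<subseteq> topspace X \<and> (\<forall>x\<in>V. \<exists>E\<in>U. E `` {x} \<subseteq> V)"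
proof -
  note us = assms[unfolded compatible_uniformity_def, THEN conjunct1]
    and op = assms[unfolded compatible_uniformity_def, THEN conjunct2]
  show "\<And>V. openin X V \<longleftrightarrow> V \<subseteq> topspace X \<and> (\<forall>x\<in>V. \<exists>E\<in>U. E `` {x} \<subseteq> V)"
    by (rule op[rule_format])
  note us = us[unfolded uniform_structure_def]
  show "U \<noteq> {}" by (rule us[THEN conjunct1])
  show "\<And>E. E \<in> U \<Longrightarrow> E \<subseteq> topspace X \<times> topspace X \<and> Id_on (topspace X) \<subseteq> E \<and>
      E\<inverse> \<in> U \<and> (\<exists>D\<in>U. D O D \<subseteq> E)"
    by (rule bspec[OF us[THEN conjunct2, THEN conjunct1]])
  show "\<And>E D. E \<in> U \<Longrightarrow> D \<in> U \<Longrightarrow> E \<inter> D \<in> U"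
    by (rule us[THEN conjunct2, THEN conjunct2, THEN conjunct1, rule_format])
  show "\<And>E D. E \<in> U \<Longrightarrow> E \<subseteq> D \<Longrightarrow> D \<subseteq> topspace X \<times> topspace X \<Longrightarrow> D \<in> U"
    using us[THEN conjunct2, THEN conjunct2, THEN conjunct2] by meson
qed

lemma compatible_uniformity_interior:
  assumes "compatible_uniformity X U" "D \<in> U" "x \<in> topspace X"
  obtains A where "openin X A" "x \<in> A" "A \<subseteq> D `` {x}"
proof -
  let ?S = "topspace X"
  note us = compatible_uniformityD[OF assms(1)]
  note U = us(1) and op = us(5)
  define A where "A = {y \<in> ?S. \<exists>E\<in>U. E `` {y} \<subseteq> D `` {x}}"
  have "\<exists>E\<in>U. E `` {y} \<subseteq> A" if y: "y \<in> A" for y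
  proof -
    obtain E where E: "E \<in> U" "E `` {y} \<subseteq> D `` {x}" using y A_def by blast
    obtain E' where E': "E' \<in> U" "E' O E' \<subseteq> E" using U E by blast
    have "E' `` {y} \<subseteq> A"
    proof
      fix z assume z: "z \<in> E' `` {y}"
      then have "E' `` {z} \<subseteq> E `` {y}" using E' by blast
      moreover have "z \<in> ?S" using U[OF E'(1)] z by blast
      ultimately show "z \<in> A" using E E' unfolding A_def by blast
    qed
    then show ?thesis using E' by blast
  qed
  then have "openin X A" unfolding op by (auto simp: A_def)
  moreover have "x \<in> A" using assms unfolding A_def by blast
  moreover have "A \<subseteq> D `` {x}" using U unfolding A_def by (blast intro: Id_onI)
  ultimately show ?thesis using that by blast
qed

lemma compatible_uniformity_unique:
  assumes "compact_space X" "compatible_uniformity X U"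
  shows "U = diagonal_neighbourhoods X"
proof -
  let ?S = "topspace X" and ?N = "diagonal_neighbourhoods X" and ?XX = "prod_topology X X"
  note us = compatible_uniformityD[OF assms(2)]
  note U = us(1) and Uint = us(2) and Usup = us(3) and Une = us(4) and op = us(5)
  have "E \<in> ?N" if E: "E \<in> U" for E
  proof -
    obtain D\<^sub>0 where D0: "D\<^sub>0 \<in> U" "D\<^sub>0 O D\<^sub>0 \<subseteq> E" using U E by blast
    define D where "D = D\<^sub>0 \<inter> D\<^sub>0\<inverse>"
    have D: "D \<in> U" "D O D \<subseteq> E" "D\<inverse> = D" using D0 U Uint unfolding D_def by auto
    have "\<forall>x\<in>?S. \<exists>A. openin X A \<and> x \<in> A \<and> A \<subseteq> D `` {x}"
      using compatible_uniformity_interior[OF assms(2) D(1)] by metis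
    then obtain A where A: "\<And>x. x \<in> ?S \<Longrightarrow> openin X (A x) \<and> x \<in> A x \<and> A x \<subseteq> D `` {x}"
      by metis
    let ?W = "\<Union>x\<in>?S. A x \<times> A x"
    have "openin ?XX ?W" using A by (intro openin_Union) (auto simp: openin_prod_Times_iff)
    moreover have "Id_on ?S \<subseteq> ?W" using A by blast
    moreover have "?W \<subseteq> E"
    proof clarify
      fix x a b assume "x \<in> ?S" "a \<in> A x" "b \<in> A x"
      then have "(x, a) \<in> D" "(x, b) \<in> D" using A by blast+
      then show "(a, b) \<in> E" using D by blast
    qed
    ultimately show ?thesis using U[OF E] unfolding diagonal_neighbourhoods_def by blast
  qed
  then have "U \<subseteq> ?N" by (rule subsetI)
  moreover have "E \<in> U" if E: "E \<in> ?N" for E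
  proof -
    obtain W where W: "openin ?XX W" "Id_on ?S \<subseteq> W" "W \<subseteq> E" "E \<subseteq> ?S \<times> ?S"
      using E unfolding diagonal_neighbourhoods_def by blast
    have "\<exists>P D A. P \<times> P \<subseteq> W \<and> D \<in> U \<and> (D O D) `` {x} \<subseteq> P \<and> openin X A \<and> x \<in> A \<and> A \<subseteq> D `` {x}"
      if x: "x \<in> ?S" for x
    proof -
      have "(x, x) \<in> W" using W x by auto
      then obtain P Q where PQ: "openin X P" "openin X Q" "x \<in> P" "x \<in> Q" "P \<times> Q \<subseteq> W"
        using W(1) unfolding openin_prod_topology_alt by metis
      have "openin X (P \<inter> Q)" "x \<in> P \<inter> Q" using PQ by auto
      then obtain E' where E': "E' \<in> U" "E' `` {x} \<subseteq> P \<inter> Q" using op by blast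
      obtain D where D: "D \<in> U" "D O D \<subseteq> E'" using U E' by blast
      obtain A where "openin X A" "x \<in> A" "A \<subseteq> D `` {x}"
        using compatible_uniformity_interior[OF assms(2) D(1) x] by blast
      moreover have "(P \<inter> Q) \<times> (P \<inter> Q) \<subseteq> W" "(D O D) `` {x} \<subseteq> P \<inter> Q" using PQ D E' by blast+
      ultimately show ?thesis using D by blast
    qed
    then obtain P D A where PDA: "\<And>x. x \<in> ?S \<Longrightarrow> P x \<times> P x \<subseteq> W \<and> D x \<in> U \<and>
        (D x O D x) `` {x} \<subseteq> P x \<and> openin X (A x) \<and> x \<in> A x \<and> A x \<subseteq> D x `` {x}"
      by metis
    obtain T where T: "finite T" "T \<subseteq> ?S" "?S \<subseteq> \<Union>(A ` T)"
      by (rule compact_space_pointwise_cover[OF assms(1), of A]) (use PDA in auto)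
    obtain E\<^sub>1 where E1: "E\<^sub>1 \<in> U" using Une by blast
    have fin: "E\<^sub>1 \<inter> (\<Inter>x\<in>T'. D x) \<in> U" if "finite T'" "T' \<subseteq> ?S" for T'
      using that
    proof (induction T')
      case empty then show ?case using E1 by simp
    next
      case (insert x T')
      have "E\<^sub>1 \<inter> (\<Inter>x\<in>insert x T'. D x) = (E\<^sub>1 \<inter> (\<Inter>x\<in>T'. D x)) \<inter> D x" by auto
      then show ?case using Uint insert PDA by simp
    qed
    have "E\<^sub>1 \<inter> (\<Inter>x\<in>T. D x) \<subseteq> W"
    proof clarify
      fix a b assume ab: "(a, b) \<in> E\<^sub>1" "(a, b) \<in> (\<Inter>x\<in>T. D x)"
      then have "a \<in> ?S" using U E1 by blast
      then obtain x where x: "x \<in> T" "a \<in> A x" using T by blast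
      have xS: "x \<in> ?S" and Dx: "D x \<in> U" using x T PDA[of x] by auto
      have "(x, a) \<in> D x" using PDA[OF xS] x by auto
      moreover have "(x, x) \<in> D x" using U[OF Dx] xS by auto
      moreover have "(a, b) \<in> D x" using ab x by auto
      ultimately have "(x, a) \<in> D x O D x" "(x, b) \<in> D x O D x" by auto
      then have "a \<in> P x" "b \<in> P x" using PDA[of x] x T by blast+
      then show "(a, b) \<in> W" using PDA[of x] x T by blast
    qed
    then have "E\<^sub>1 \<inter> (\<Inter>x\<in>T. D x) \<subseteq> E" using W(3) by (rule order_trans)
    then show ?thesis by (rule Usup[OF fin[OF T(1,2)] _ W(4)])
  qed
  then have "?N \<subseteq> U" by (rule subsetI)
  ultimately show ?thesis by (rule equalityI)
qed

lemma ex1_compatible_uniformity: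
  assumes "compact_space X" "Hausdorff_space X"
  shows "\<exists>!U. compatible_uniformity X U"
  using diagonal_neighbourhoods_compatible[OF assms] compatible_uniformity_unique[OF assms(1)]
  by metis

lemma the_uniformity_eq:
  assumes "compact_space X" "Hausdorff_space X"
  shows "the_uniformity X = diagonal_neighbourhoods X"
  unfolding the_uniformity_def
  by (rule the1_equality[OF ex1_compatible_uniformity[OF assms]
        diagonal_neighbourhoods_compatible[OF assms]])


subsection \<open>Independence of the type carrying the system\<close>

lemma compact_systemD:
  assumes "compact_system X act"
  shows "compact_space X" "Hausdorff_space X"
    "continuous_map (prod_topology euclidean X) X (\<lambda>(g, x). act g x)"
    "\<And>x. x \<in> topspace X \<Longrightarrow> act 0 x = x"
    "\<And>g h x. x \<in> topspace X \<Longrightarrow> act (g + h) x = act g (act h x)"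
  using assms unfolding compact_system_def by auto

lemma compact_system_continuous:
  assumes "compact_system X act"
  shows "continuous_map X X (act g)"
    and "x \<in> topspace X \<Longrightarrow> continuous_map euclidean X (\<lambda>g. act g x)"
    and "x \<in> topspace X \<Longrightarrow> act g x \<in> topspace X"
proof -
  note c = compact_systemD(3)[OF assms]
  have "continuous_map X (prod_topology euclidean X) (\<lambda>x. (g, x))"
    by (simp add: continuous_map_pairedI)
  from continuous_map_compose[OF this c] show *: "continuous_map X X (act g)"
    by (simp add: o_def)
  show "act g x \<in> topspace X" if "x \<in> topspace X"
    using * that by (auto simp: continuous_map_def)
  show "continuous_map euclidean X (\<lambda>g. act g x)" if "x \<in> topspace X"
  proof -
    have "continuous_map euclidean (prod_topology euclidean X) (\<lambda>g. (g, x))"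
      using that by (simp add: continuous_map_pairedI)
    from continuous_map_compose[OF this c] show ?thesis by (simp add: o_def)
  qed
qed

lemma compact_system_subtopology:
  assumes "compact_system X act" "closedin X Y" "invariant_set act Y"
  shows "compact_system (subtopology X Y) act"
proof -
  note c = compact_systemD[OF assms(1)]
  have YX: "Y \<subseteq> topspace X" using assms(2) closedin_subset by blast
  have "compact_space (subtopology X Y)"
    using assms(2) c(1) by (simp add: closedin_compact_space compact_space_subtopology)
  moreover have "Hausdorff_space (subtopology X Y)" using c(2) by (rule Hausdorff_space_subtopology)
  moreover have "continuous_map (prod_topology euclidean (subtopology X Y)) (subtopology X Y) (\<lambda>(g, x). act g x)"
  proof -
    have "prod_topology euclidean (subtopology X Y) = subtopology (prod_topology euclidean X) (UNIV \<times> Y)"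
      by (simp add: prod_topology_subtopology)
    then have "continuous_map (prod_topology euclidean (subtopology X Y)) X (\<lambda>(g, x). act g x)"
      using continuous_map_from_subtopology[OF c(3)] by metis
    then show ?thesis
      using assms(3) by (auto simp: continuous_map_in_subtopology invariant_set_def)
  qed
  ultimately show ?thesis using c(4,5) YX unfolding compact_system_def by auto
qed

lemma HNS_subtopology:
  assumes "HNS X act" "closedin X Y"
  shows "HNS (subtopology X Y) act"
  unfolding HNS_def
proof (intro allI impI)
  fix K assume K: "closedin (subtopology X Y) K \<and> K \<noteq> {} \<and> invariant_set act K"
  then have "closedin X K" "K \<subseteq> Y"
    using assms(2) closedin_closed_subtopology by blast+
  then have "nonsensitive (subtopology X K) act" using assms(1) K unfolding HNS_def by blast
  moreover have "subtopology (subtopology X Y) K = subtopology X K"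
    using \<open>K \<subseteq> Y\<close> by (simp add: subtopology_subtopology Int_absorb1)
  ultimately show "nonsensitive (subtopology (subtopology X Y) K) act" by simp
qed

lemma nonsensitive_homeomorphic:
  assumes X: "compact_space X" "Hausdorff_space X" and j: "homeomorphic_map X X' j"
    and eq: "\<And>g x. x \<in> topspace X \<Longrightarrow> act' g (j x) = j (act g x)"
    and ns: "nonsensitive X act"
  shows "nonsensitive X' act'"
  unfolding nonsensitive_def
proof
  let ?S = "topspace X" and ?S' = "topspace X'"
  have X': "compact_space X'" "Hausdorff_space X'"
    using X j homeomorphic_map_imp_homeomorphic_space homeomorphic_compact_space
      homeomorphic_Hausdorff_space by blast+
  have cj: "continuous_map X X' j" and jS: "j ` ?S = ?S'"
    using j homeomorphic_imp_continuous_map homeomorphic_imp_surjective_map by blast+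
  fix E' assume "E' \<in> the_uniformity X'"
  then have E': "E' \<in> diagonal_neighbourhoods X'" using the_uniformity_eq[OF X'] by simp
  obtain W' where W': "openin (prod_topology X' X') W'" "Id_on ?S' \<subseteq> W'" "W' \<subseteq> E'"
      "E' \<subseteq> ?S' \<times> ?S'"
    using diagonal_neighbourhoodsE[OF E'] by metis
  let ?jj = "\<lambda>p. (j (fst p), j (snd p))"
  have "continuous_map (prod_topology X X) (prod_topology X' X') ?jj"
    by (intro continuous_map_pairedI continuous_map_compose[OF continuous_map_fst cj, unfolded o_def]
        continuous_map_compose[OF continuous_map_snd cj, unfolded o_def])
  define W where "W = {p \<in> topspace (prod_topology X X). ?jj p \<in> W'}"
  have "openin (prod_topology X X) W"
    unfolding W_def by (rule openin_continuous_map_preimage) fact+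
  moreover have "Id_on ?S \<subseteq> W" using W'(2) jS unfolding W_def by (auto simp: subset_iff Id_on_iff)
  moreover have "W \<subseteq> ?S \<times> ?S" unfolding W_def by auto
  ultimately have "W \<in> the_uniformity X"
    unfolding the_uniformity_eq[OF X] by (intro diagonal_neighbourhoodsI[of _ W]) auto
  then obtain V where V: "openin X V" "V \<noteq> {}" "\<And>g. (act g ` V) \<times> (act g ` V) \<subseteq> W"
    using ns unfolding nonsensitive_def by metis
  have VS: "V \<subseteq> ?S" using V(1) openin_subset by blast
  have "openin X' (j ` V)" using homeomorphic_map_openness[OF j VS] V(1) by simp
  moreover have "j ` V \<noteq> {}" using V(2) by simp
  moreover have "(act' g ` j ` V) \<times> (act' g ` j ` V) \<subseteq> E'" for g
  proof -
    have "(act' g (j x), act' g (j y)) \<in> E'" if xy: "x \<in> V" "y \<in> V" for x y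
    proof -
      have "(act g x, act g y) \<in> W" using V(3)[of g] xy by auto
      then have "(j (act g x), j (act g y)) \<in> E'" using W'(3) unfolding W_def by auto
      then show ?thesis using eq xy VS by (simp add: subset_iff)
    qed
    then show ?thesis by auto
  qed
  ultimately show "\<exists>V. openin X' V \<and> V \<noteq> {} \<and> (\<forall>g. (act' g ` V) \<times> (act' g ` V) \<subseteq> E')"
    by blast
qed

lemma HNS_homeomorphic:
  assumes X: "compact_system X act" and j: "homeomorphic_map X X' j"
    and eq: "\<And>g x. x \<in> topspace X \<Longrightarrow> act' g (j x) = j (act g x)"
    and hns: "HNS X act"
  shows "HNS X' act'"
  unfolding HNS_def
proof (intro allI impI)
  fix Y' assume Y': "closedin X' Y' \<and> Y' \<noteq> {} \<and> invariant_set act' Y'"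
  have cj: "continuous_map X X' j" and jS: "j ` topspace X = topspace X'"
    using j homeomorphic_imp_continuous_map homeomorphic_imp_surjective_map by blast+
  define Y where "Y = {x \<in> topspace X. j x \<in> Y'}"
  have Y: "closedin X Y" 
    unfolding Y_def using cj Y' by (auto intro: closedin_continuous_map_preimage)
  have jY: "j ` Y = Y'" using jS closedin_subset[of X' Y'] Y' unfolding Y_def by auto
  have "Y \<noteq> {}" using jY Y' by auto
  moreover have inv: "invariant_set act Y"
    unfolding invariant_set_def Y_def
    using Y' eq compact_system_continuous(3)[OF X]
    by (auto simp: invariant_set_def simp flip: eq)
  ultimately have ns: "nonsensitive (subtopology X Y) act" using hns Y unfolding HNS_def by blast
  note sub = compact_systemD[OF compact_system_subtopology[OF X Y inv]]
  have "homeomorphic_map (subtopology X Y) (subtopology X' Y') j"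
    using j jY closedin_subset[OF Y] closedin_subset[of X' Y'] Y'
    by (intro homeomorphic_map_subtopologies) (auto simp: Int_absorb1)
  then show "nonsensitive (subtopology X' Y') act'"
    by (rule nonsensitive_homeomorphic[OF sub(1,2) _ _ ns]) (simp add: eq)
qed

lemma compact_system_homeomorphic:
  assumes X: "compact_system X act" and jk: "homeomorphic_maps X X' j k"
  shows "compact_system X' (\<lambda>g x'. j (act g (k x')))"
proof -
  note c = compact_systemD[OF X]
  have j: "homeomorphic_map X X' j" using jk homeomorphic_maps_map by blast
  have cj: "continuous_map X X' j" and ck: "continuous_map X' X k"
    and kj: "\<And>x. x \<in> topspace X \<Longrightarrow> k (j x) = x"
    and jk': "\<And>y. y \<in> topspace X' \<Longrightarrow> j (k y) = y"
    using jk unfolding homeomorphic_maps_def by auto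
  have k_in: "k y \<in> topspace X" if "y \<in> topspace X'" for y
    using ck that by (auto simp: continuous_map_def)
  have "compact_space X'" "Hausdorff_space X'"
    using c(1,2) j homeomorphic_map_imp_homeomorphic_space homeomorphic_compact_space
      homeomorphic_Hausdorff_space by blast+
  moreover have "continuous_map (prod_topology euclidean X') X' (\<lambda>(g, y). j (act g (k y)))"
  proof -
    have "continuous_map (prod_topology euclidean X') (prod_topology euclidean X) (\<lambda>p. (fst p, k (snd p)))"
      by (intro continuous_map_pairedI continuous_map_fst
          continuous_map_compose[OF continuous_map_snd ck, unfolded o_def])
    from continuous_map_compose[OF continuous_map_compose[OF this c(3)] cj]
    show ?thesis by (simp add: o_def case_prod_unfold)
  qed
  ultimately show ?thesis
    unfolding compact_system_def using c(4,5) k_in kj jk' compact_system_continuous(3)[OF X] by simp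
qed

lemma homeomorphic_image_topology:
  fixes j :: "'x \<Rightarrow> 'y"
  assumes "inj_on j (topspace X)"
  obtains X' :: "'y topology" and k where "homeomorphic_maps X X' j k"
proof -
  let ?k = "inv_into (topspace X) j"
  define X' where "X' = pullback_topology (j ` topspace X) ?k X"
  have kj: "\<And>x. x \<in> topspace X \<Longrightarrow> ?k (j x) = x" using assms by simp
  have top: "topspace X' = j ` topspace X"
    unfolding X'_def topspace_pullback_topology using kj by auto
  have "continuous_map X' X ?k"
    unfolding X'_def
    by (rule continuous_map_pullback[OF continuous_map_id, unfolded id_comp])
  moreover have "continuous_map X X' j"
    unfolding X'_def
  proof (rule continuous_map_pullback')
    show "continuous_map X X (?k \<circ> j)"
      by (rule continuous_map_eq[OF continuous_map_id]) (simp add: kj)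
  qed auto
  ultimately have "homeomorphic_maps X X' j ?k"
    unfolding homeomorphic_maps_def using kj top by auto
  then show ?thesis using that by blast
qed

lemma orbit_closure_invariant:
  assumes "compact_system X act" "x\<^sub>0 \<in> topspace X"
  shows "invariant_set act (X closure_of range (\<lambda>g. act g x\<^sub>0))"
  unfolding invariant_set_def
proof (intro allI ballI)
  let ?O = "range (\<lambda>g. act g x\<^sub>0)"
  fix h y assume y: "y \<in> X closure_of ?O"
  have "act h ` (X closure_of ?O) \<subseteq> X closure_of (act h ` ?O)"
    by (rule continuous_map_image_closure_subset) (rule compact_system_continuous(1)[OF assms(1)])
  moreover have "act h ` ?O \<subseteq> ?O"
    using compact_systemD(5)[OF assms(1,2)] by (auto simp: image_iff) metis
  ultimately show "act h y \<in> X closure_of ?O" using y closure_of_mono by blast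
qed

lemma Asp_I:
  fixes X :: "'x topology" and act :: "'g::topological_group_add \<Rightarrow> 'x \<Rightarrow> 'x"
  assumes X: "compact_system X act" and hns: "HNS X act"
    and F: "continuous_map X euclideanreal F" and x0: "x\<^sub>0 \<in> topspace X"
  shows "(\<lambda>g. F (act g x\<^sub>0)) \<in> Asp"
proof -
  let ?O = "range (\<lambda>g. act g x\<^sub>0)"
  define Y where "Y = X closure_of ?O"
  have Y: "closedin X Y" "invariant_set act Y" "Y \<subseteq> topspace X"
    unfolding Y_def by (simp_all add: orbit_closure_invariant[OF X x0] closure_of_subset_topspace)
  have "?O \<subseteq> topspace X" using compact_system_continuous(3)[OF X x0] by auto
  then have OY: "?O \<subseteq> Y" unfolding Y_def by (rule closure_of_subset)
  moreover have "x\<^sub>0 \<in> ?O" using compact_systemD(4)[OF X x0] by (metis rangeI)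
  ultimately have x0Y: "x\<^sub>0 \<in> Y" by blast
  let ?Y = "subtopology X Y"
  have topY: "topspace ?Y = Y" using Y(3) by (simp add: Int_absorb1)
  have sysY: "compact_system ?Y act" and hnsY: "HNS ?Y act"
    using compact_system_subtopology[OF X Y(1,2)] HNS_subtopology[OF hns Y(1)] by auto
  define j where "j y = {A. y \<in> X closure_of ((\<lambda>g. act g x\<^sub>0) ` A)}" for y
  have "y = z" if yz: "y \<in> Y" "z \<in> Y" "j y = j z" for y z
  proof (rule ccontr)
    assume "y \<noteq> z"
    then obtain U V where UV: "openin X U" "openin X V" "y \<in> U" "z \<in> V" "disjnt U V"
      using compact_systemD(2)[OF X] yz(1,2) Y(3) unfolding Hausdorff_space_def by (meson subsetD)
    let ?A = "{g. act g x\<^sub>0 \<in> U}"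
    have im: "(\<lambda>g. act g x\<^sub>0) ` ?A = U \<inter> ?O" by auto
    have "y \<in> X closure_of (U \<inter> ?O)"
      using openin_Int_closure_of_subset[OF UV(1), of ?O] yz(1) UV(3) unfolding Y_def by blast
    then have "?A \<in> j y" unfolding j_def im[symmetric] by simp
    then have "z \<in> X closure_of (U \<inter> ?O)" using yz(3) im unfolding j_def by simp
    then obtain w where "w \<in> U \<inter> ?O" "w \<in> V" using UV unfolding in_closure_of by blast
    then show False using UV(5) by (auto simp: disjnt_def)
  qed
  then have "inj_on j (topspace ?Y)" unfolding topY by (rule inj_onI)
  then obtain X' :: "'g set set topology" and k where jk: "homeomorphic_maps ?Y X' j k"
    using homeomorphic_image_topology by blast
  define act' where "act' = (\<lambda>g x'. j (act g (k x')))"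
  have kj: "\<And>y. y \<in> Y \<Longrightarrow> k (j y) = y" and ck: "continuous_map X' ?Y k"
    and cj: "continuous_map ?Y X' j"
    using jk topY unfolding homeomorphic_maps_def by auto
  have sys': "compact_system X' act'"
    unfolding act'_def using compact_system_homeomorphic[OF sysY jk] .
  have hns': "HNS X' act'"
  proof (rule HNS_homeomorphic[OF sysY _ _ hnsY])
    show "homeomorphic_map ?Y X' j" using jk homeomorphic_maps_map by blast
    show "act' g (j y) = j (act g y)" if "y \<in> topspace ?Y" for g y
      using that kj topY by (simp add: act'_def)
  qed
  have "continuous_map X' X k" using ck continuous_map_in_subtopology by blast
  then have F': "continuous_map X' euclideanreal (F \<circ> k)" using F by (rule continuous_map_compose)
  have x0': "j x\<^sub>0 \<in> topspace X'" using cj x0Y topY by (auto simp: continuous_map_def)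
  have val: "F (act g x\<^sub>0) = (F \<circ> k) (act' g (j x\<^sub>0))" for g
  proof -
    have "act g x\<^sub>0 \<in> Y" using OY by auto
    then show ?thesis using kj x0Y by (simp add: act'_def)
  qed
  have "continuous_map euclidean euclideanreal (\<lambda>g. F (act g x\<^sub>0))"
    using continuous_map_compose[OF compact_system_continuous(2)[OF X x0] F] by (simp add: o_def)
  then have "continuous_on UNIV (\<lambda>g. F (act g x\<^sub>0))" by simp
  moreover have "bounded (range (\<lambda>g. F (act g x\<^sub>0)))"
  proof -
    have "compactin euclideanreal (F ` topspace X)"
      using image_compactin F compact_systemD(1)[OF X] unfolding compact_space_def by blast
    then have "bounded (F ` topspace X)" by (simp add: compact_imp_bounded)
    moreover have "range (\<lambda>g. F (act g x\<^sub>0)) \<subseteq> F ` topspace X"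
      using compact_system_continuous(3)[OF X x0] by auto
    ultimately show ?thesis by (rule bounded_subset)
  qed
  ultimately show ?thesis unfolding Asp_def using sys' hns' F' x0' val by blast
qed

end

theory Submission
  imports Defs
begin

text \<open>
  Hereditary nonsensitivity of \<open>X\<close> makes every continuous function on \<open>X\<close> fragmented along
  orbits: every nonempty subset \<open>A\<close> of \<open>X\<close>, invariant or not, has a nonempty relatively open
  piece on which all translates of the function oscillate by less than a given \<open>e\<close>
  (\<open>HNS_imp_orbit_fragmented\<close>). Conversely, it is enough to know this for a family of
  functions that separates the points (\<open>HNS_if_separating_orbit_fragmented\<close>). As the second
  criterion can be checked coordinate by coordinate, arbitrary products of hereditarily
  nonsensitive systems are hereditarily nonsensitive. Hence a single system \<open>X\<close> with a single
  point \<open>x\<^sub>0\<close>, a product indexed by all Asplund functions, represents all of them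
  (\<open>Asp_universal_system\<close>), which makes the Asplund functions a translation invariant space.

  For the mean, take a minimal subsystem \<open>M\<close> inside the closure of the orbit of \<open>x\<^sub>0\<close>. Since
  every orbit in \<open>M\<close> meets the open piece provided by fragmentation, \<open>M\<close> is covered by finitely
  many sets on which all translates of finitely many given functions oscillate by at most \<open>e\<close>;
  so on \<open>M\<close> the functions behave like almost periodic ones. The mean of an almost periodic function
  is then found by an argument in the style of von Neumann and Maak: choose such a cover with the
  least number of members and one point in each member. Translating the cover by \<open>g\<close> gives another
  least cover, and two least covers have nearly the same averages, because exchanging the members
  on which a function is large for the corresponding members of the other cover must not make
  the cover smaller (\<open>minimal_cover_almost_invariant\<close>). So the averages over the chosen points are
  almost invariant under all of \<open>G\<close>.

  The chosen points lie in the closure of the orbit of \<open>x\<^sub>0\<close>, hence can be replaced by points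
  \<open>t x\<^sub>0\<close> as long as only finitely many group elements matter. This yields averages of
  evaluations at points of \<open>G\<close> that are almost invariant for finitely many functions and finitely
  many translations (\<open>Asp_almost_invariant_averages\<close>), and compactness of the set of
  means turns them into an invariant mean (\<open>left_amenable_if_almost_invariant_means\<close>).
\<close>

section \<open>Fragmentation of continuous functions along orbits\<close>

definition orbit_fragmented :: "'x topology \<Rightarrow> ('g \<Rightarrow> 'x \<Rightarrow> 'x) \<Rightarrow> ('x \<Rightarrow> real) \<Rightarrow> bool" where
  "orbit_fragmented X act F \<longleftrightarrow>
     (\<forall>A e. A \<subseteq> topspace X \<and> A \<noteq> {} \<and> e > 0 \<longrightarrow>
        (\<exists>U. openin X U \<and> U \<inter> A \<noteq> {} \<and>
           (\<forall>g. \<forall>x\<in>U \<inter> A. \<forall>y\<in>U \<inter> A. \<bar>F (act g x) - F (act g y)\<bar> < e)))"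

lemma orbit_fragmentedE:
  assumes "orbit_fragmented X act F" "A \<subseteq> topspace X" "A \<noteq> {}" "e > 0"
  obtains U where "openin X U" "U \<inter> A \<noteq> {}"
    "\<And>g x y. x \<in> U \<inter> A \<Longrightarrow> y \<in> U \<inter> A \<Longrightarrow> \<bar>F (act g x) - F (act g y)\<bar> < e"
  using assms unfolding orbit_fragmented_def by meson

text \<open>
  One piece serves finitely many functions: each function in turn cuts a smaller piece out of the
  piece found before, which is again just a nonempty set.
\<close>

lemma orbit_fragmented_finite:
  assumes "finite \<Phi>" "\<And>F. F \<in> \<Phi> \<Longrightarrow> orbit_fragmented X act F"
    and A: "A \<subseteq> topspace X" "A \<noteq> {}" and e: "e > 0"
  obtains U where "openin X U" "U \<inter> A \<noteq> {}"
    "\<And>F g x y. F \<in> \<Phi> \<Longrightarrow> x \<in> U \<inter> A \<Longrightarrow> y \<in> U \<inter> A \<Longrightarrow> \<bar>F (act g x) - F (act g y)\<bar> < e"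
proof -
  have "\<exists>U. openin X U \<and> U \<inter> A \<noteq> {} \<and>
      (\<forall>F\<in>\<Phi>. \<forall>g. \<forall>x\<in>U \<inter> A. \<forall>y\<in>U \<inter> A. \<bar>F (act g x) - F (act g y)\<bar> < e)"
    using assms(1,2)
  proof (induction \<Phi>)
    case empty
    then show ?case using A by (intro exI[of _ "topspace X"]) auto
  next
    case (insert F \<Phi>)
    then obtain U where U: "openin X U" "U \<inter> A \<noteq> {}"
        "\<forall>F\<in>\<Phi>. \<forall>g. \<forall>x\<in>U \<inter> A. \<forall>y\<in>U \<inter> A. \<bar>F (act g x) - F (act g y)\<bar> < e"
      by auto
    have F: "orbit_fragmented X act F" using insert.prems by simp
    have UA: "U \<inter> A \<subseteq> topspace X" using A by blast
    obtain V where V: "openin X V" "V \<inter> (U \<inter> A) \<noteq> {}"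
        "\<And>g x y. x \<in> V \<inter> (U \<inter> A) \<Longrightarrow> y \<in> V \<inter> (U \<inter> A) \<Longrightarrow> \<bar>F (act g x) - F (act g y)\<bar> < e"
      using orbit_fragmentedE[OF F UA U(2) e] by metis
    have "openin X (V \<inter> U)" "(V \<inter> U) \<inter> A \<noteq> {}" using U V by auto
    moreover have "\<forall>F'\<in>insert F \<Phi>. \<forall>g. \<forall>x\<in>(V \<inter> U) \<inter> A. \<forall>y\<in>(V \<inter> U) \<inter> A.
        \<bar>F' (act g x) - F' (act g y)\<bar> < e"
      using U(3) V(3) by (simp add: Int_assoc)
    ultimately show ?case by blast
  qed
  then show ?thesis using that by blast
qed

lemma continuous_map_oscillation:
  assumes "continuous_map X euclideanreal F"
  shows "continuous_map (prod_topology X X) euclideanreal (\<lambda>p. \<bar>F (fst p) - F (snd p)\<bar>)"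
  by (intro continuous_map_real_abs continuous_map_diff
      continuous_map_compose[OF continuous_map_fst assms, unfolded o_def]
      continuous_map_compose[OF continuous_map_snd assms, unfolded o_def])

lemma invariant_closure_of:
  assumes "compact_system X act" "invariant_set act S"
  shows "invariant_set act (X closure_of S)"
  unfolding invariant_set_def
proof (intro allI ballI)
  fix h y assume y: "y \<in> X closure_of S"
  have "act h ` (X closure_of S) \<subseteq> X closure_of (act h ` S)"
    by (rule continuous_map_image_closure_subset) (rule compact_system_continuous(1)[OF assms(1)])
  moreover have "act h ` S \<subseteq> S" using assms(2) unfolding invariant_set_def by auto
  ultimately show "act h y \<in> X closure_of S" using y closure_of_mono by blast
qed

text \<open>
  Nonsensitivity applies to the closed invariant set generated by \<open>A\<close> and yields an open set whose
  translates are all small. It meets some translate \<open>h A\<close>, so its preimage under \<open>h\<close> meets \<open>A\<close>; and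
  the translates of this preimage are small, being translates of the original set.
\<close>

lemma HNS_imp_orbit_fragmented:
  fixes act :: "'g::topological_group_add \<Rightarrow> 'x \<Rightarrow> 'x"
  assumes X: "compact_system X act" and hns: "HNS X act"
    and F: "continuous_map X euclideanreal F"
  shows "orbit_fragmented X act F"
  unfolding orbit_fragmented_def
proof (intro allI impI)
  fix A and e :: real
  assume A: "A \<subseteq> topspace X \<and> A \<noteq> {} \<and> e > 0"
  note act = compact_systemD(4,5)[OF X] and act_in = compact_system_continuous(3)[OF X]
  define GA where "GA = (\<Union>g. act g ` A)"
  define Z where "Z = X closure_of GA"
  let ?Z = "subtopology X Z"
  have GA: "GA \<subseteq> topspace X" using A act_in unfolding GA_def by blast
  have GAZ: "GA \<subseteq> Z" unfolding Z_def by (rule closure_of_subset[OF GA])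
  have "invariant_set act GA"
    unfolding invariant_set_def
  proof (intro allI ballI)
    fix h y assume "y \<in> GA"
    then obtain g x where x: "x \<in> A" "y = act g x" unfolding GA_def by blast
    then have "act h y = act (h + g) x" using act(2)[of x h g] A by auto
    then show "act h y \<in> GA" using x unfolding GA_def by blast
  qed
  then have inv: "invariant_set act Z" unfolding Z_def by (rule invariant_closure_of[OF X])
  have Z: "closedin X Z" unfolding Z_def by simp
  have "GA \<noteq> {}" using A unfolding GA_def by blast
  then have "nonsensitive ?Z act" using hns Z inv GAZ unfolding HNS_def by blast
  moreover have topZ: "topspace ?Z = Z" using closedin_subset[OF Z] by auto
  define E where "E = {p \<in> topspace (prod_topology ?Z ?Z). \<bar>F (fst p) - F (snd p)\<bar> \<in> {..<e}}"
  have "openin (prod_topology ?Z ?Z) E"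
    unfolding E_def
    by (rule openin_continuous_map_preimage
        [OF continuous_map_oscillation[OF continuous_map_from_subtopology[OF F]]]) simp
  then have "E \<in> diagonal_neighbourhoods ?Z"
    by (rule diagonal_neighbourhoodsI) (use A in \<open>auto simp: E_def\<close>)
  then have "E \<in> the_uniformity ?Z"
    using the_uniformity_eq compact_systemD(1,2)[OF compact_system_subtopology[OF X Z inv]] by metis
  ultimately obtain V where V: "openin ?Z V" "V \<noteq> {}" "\<And>g. (act g ` V) \<times> (act g ` V) \<subseteq> E"
    unfolding nonsensitive_def by metis
  obtain V' where V': "openin X V'" "V = V' \<inter> Z"
    using V(1) unfolding openin_subtopology by blast
  have "V' \<inter> GA \<noteq> {}"
    using V(2) V' openin_Int_closure_of_eq_empty[OF V'(1), of GA] unfolding Z_def by auto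
  then obtain h a where a: "a \<in> A" "act h a \<in> V'" unfolding GA_def by blast
  define U where "U = {x \<in> topspace X. act h x \<in> V'}"
  have "openin X U"
    unfolding U_def by (rule openin_continuous_map_preimage[OF compact_system_continuous(1)[OF X] V'(1)])
  moreover have "U \<inter> A \<noteq> {}" using a A unfolding U_def by blast
  moreover have "\<bar>F (act g x) - F (act g y)\<bar> < e" if xy: "x \<in> U \<inter> A" "y \<in> U \<inter> A" for g x y
  proof -
    have "act h x \<in> V" "act h y \<in> V"
      using xy V' GAZ unfolding U_def GA_def by auto
    then have "(act (g - h) (act h x), act (g - h) (act h y)) \<in> E" using V(3)[of "g - h"] by auto
    moreover have "act (g - h) (act h z) = act g z" if "z \<in> A" for z
      using act(2)[of z "g - h" h] that A by auto
    ultimately show ?thesis using xy unfolding E_def by auto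
  qed
  ultimately show "\<exists>U. openin X U \<and> U \<inter> A \<noteq> {} \<and>
      (\<forall>g. \<forall>x\<in>U \<inter> A. \<forall>y\<in>U \<inter> A. \<bar>F (act g x) - F (act g y)\<bar> < e)"
    by blast
qed

text \<open>
  The complement of an open neighbourhood of the diagonal is compact and covered by the open
  sets on which some function of the family differs by more than some positive number.
\<close>

lemma separating_functions_uniformity:
  assumes X: "compact_space X" and E: "E \<in> diagonal_neighbourhoods X"
    and cont: "\<And>F. F \<in> \<F> \<Longrightarrow> continuous_map X euclideanreal F"
    and sep: "\<And>x y. x \<in> topspace X \<Longrightarrow> y \<in> topspace X \<Longrightarrow> x \<noteq> y \<Longrightarrow> \<exists>F\<in>\<F>. F x \<noteq> F y"
  obtains \<Phi> and e :: real where "finite \<Phi>" "\<Phi> \<subseteq> \<F>" "e > 0"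
    "\<And>x y. x \<in> topspace X \<Longrightarrow> y \<in> topspace X \<Longrightarrow> \<forall>F\<in>\<Phi>. \<bar>F x - F y\<bar> < e \<Longrightarrow> (x, y) \<in> E"
proof -
  let ?XX = "prod_topology X X"
  obtain W where W: "openin ?XX W" "Id_on (topspace X) \<subseteq> W" "W \<subseteq> E"
    using diagonal_neighbourhoodsE[OF E] by metis
  define O' where "O' q = {p \<in> topspace ?XX. \<bar>fst q (fst p) - fst q (snd p)\<bar> \<in> {snd q<..}}"
    for q :: "('a \<Rightarrow> real) \<times> real"
  have op: "openin ?XX (O' q)" if "q \<in> \<F> \<times> {0<..}" for q
    unfolding O'_def using that
    by (intro openin_continuous_map_preimage[OF continuous_map_oscillation] cont) auto
  have "compactin ?XX (topspace ?XX - W)"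
    using X closedin_diff[OF closedin_topspace W(1)]
    by (intro closedin_compact_space) (auto simp: compact_space_prod_topology)
  moreover have "topspace ?XX - W \<subseteq> \<Union>(O' ` (\<F> \<times> {0<..}))"
  proof
    fix p assume p: "p \<in> topspace ?XX - W"
    then have "fst p \<in> topspace X" "snd p \<in> topspace X" by auto
    moreover have "fst p \<noteq> snd p"
    proof
      assume "fst p = snd p"
      then have "p \<in> Id_on (topspace X)" using \<open>fst p \<in> topspace X\<close> by (cases p) auto
      then show False using p W(2) by blast
    qed
    ultimately obtain F where F: "F \<in> \<F>" "F (fst p) \<noteq> F (snd p)" using sep by blast
    then have "p \<in> O' (F, \<bar>F (fst p) - F (snd p)\<bar> / 2)"
      using p unfolding O'_def by simp
    then show "p \<in> \<Union>(O' ` (\<F> \<times> {0<..}))" using F by force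
  qed
  ultimately obtain \<U> where "finite \<U>" "\<U> \<subseteq> O' ` (\<F> \<times> {0<..})" "topspace ?XX - W \<subseteq> \<Union>\<U>"
    using compactinD[of ?XX "topspace ?XX - W" "O' ` (\<F> \<times> {0<..})"] op by blast
  then obtain Q where Q: "finite Q" "Q \<subseteq> \<F> \<times> {0<..}" "topspace ?XX - W \<subseteq> \<Union>(O' ` Q)"
    by (metis finite_subset_image)
  define e where "e = Min (insert 1 (snd ` Q))"
  have "e > 0" using Q(1,2) unfolding e_def by (subst Min_gr_iff) auto
  moreover have "(x, y) \<in> E"
    if xy: "x \<in> topspace X" "y \<in> topspace X" "\<forall>F\<in>fst ` Q. \<bar>F x - F y\<bar> < e" for x y
  proof (rule ccontr)
    assume "(x, y) \<notin> E"
    then have "(x, y) \<in> \<Union>(O' ` Q)" using xy(1,2) Q(3) W(3) by auto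
    then obtain q where q: "q \<in> Q" "\<bar>fst q x - fst q y\<bar> > snd q" unfolding O'_def by auto
    moreover have "e \<le> snd q" using Q(1) q(1) unfolding e_def by (intro Min_le) auto
    ultimately show False using xy(3) by auto
  qed
  moreover have "finite (fst ` Q)" "fst ` Q \<subseteq> \<F>" using Q(1,2) by auto
  ultimately show ?thesis using that[of "fst ` Q" e] by blast
qed

lemma HNS_if_separating_orbit_fragmented:
  fixes act :: "'g::topological_group_add \<Rightarrow> 'x \<Rightarrow> 'x"
  assumes X: "compact_system X act"
    and cont: "\<And>F. F \<in> \<F> \<Longrightarrow> continuous_map X euclideanreal F"
    and frag: "\<And>F. F \<in> \<F> \<Longrightarrow> orbit_fragmented X act F"
    and sep: "\<And>x y. x \<in> topspace X \<Longrightarrow> y \<in> topspace X \<Longrightarrow> x \<noteq> y \<Longrightarrow> \<exists>F\<in>\<F>. F x \<noteq> F y"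
  shows "HNS X act"
  unfolding HNS_def nonsensitive_def
proof (intro allI impI ballI)
  fix Y E assume Y: "closedin X Y \<and> Y \<noteq> {} \<and> invariant_set act Y"
    and E: "E \<in> the_uniformity (subtopology X Y)"
  let ?Y = "subtopology X Y"
  have YX: "Y \<subseteq> topspace X" using Y closedin_subset by blast
  then have topY: "topspace ?Y = Y" by auto
  have sys: "compact_system ?Y act" using X Y compact_system_subtopology by blast
  note c = compact_systemD(1,2)[OF sys]
  obtain \<Phi> and e :: real where \<Phi>: "finite \<Phi>" "\<Phi> \<subseteq> \<F>" "e > 0"
    "\<And>x y. x \<in> Y \<Longrightarrow> y \<in> Y \<Longrightarrow> \<forall>F\<in>\<Phi>. \<bar>F x - F y\<bar> < e \<Longrightarrow> (x, y) \<in> E"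
  proof (rule separating_functions_uniformity[OF c(1), of E \<F>, unfolded topY])
    show "E \<in> diagonal_neighbourhoods ?Y" using E the_uniformity_eq[OF c] by simp
    show "continuous_map ?Y euclideanreal F" if "F \<in> \<F>" for F
      by (rule continuous_map_from_subtopology[OF cont[OF that]])
    show "\<exists>F\<in>\<F>. F x \<noteq> F y" if "x \<in> Y" "y \<in> Y" "x \<noteq> y" for x y
      using that sep YX by auto
  qed (rule that)
  obtain U where U: "openin X U" "U \<inter> Y \<noteq> {}"
    "\<And>F g x y. F \<in> \<Phi> \<Longrightarrow> x \<in> U \<inter> Y \<Longrightarrow> y \<in> U \<inter> Y \<Longrightarrow> \<bar>F (act g x) - F (act g y)\<bar> < e"
  proof (rule orbit_fragmented_finite[OF \<Phi>(1), of X act Y e])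
    show "orbit_fragmented X act F" if "F \<in> \<Phi>" for F using that \<Phi>(2) frag by blast
  qed (use YX Y \<Phi>(3) in blast, use Y in blast, rule \<Phi>(3), rule that)
  have "openin ?Y (U \<inter> Y)" using U(1) by (auto simp: openin_subtopology)
  moreover have "(act g ` (U \<inter> Y)) \<times> (act g ` (U \<inter> Y)) \<subseteq> E" for g
    using \<Phi>(4) U(3) Y unfolding invariant_set_def by auto
  ultimately show "\<exists>V. openin ?Y V \<and> V \<noteq> {} \<and> (\<forall>g. (act g ` V) \<times> (act g ` V) \<subseteq> E)"
    using U(2) by blast
qed

section \<open>Products and the universal system\<close>

lemma compact_Hausdorff_separating_function:
  assumes "compact_space X" "Hausdorff_space X" "x \<in> topspace X" "y \<in> topspace X" "x \<noteq> y"
  obtains F where "continuous_map X euclideanreal F" "F x \<noteq> F y"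
proof -
  have "completely_regular_space X"
    using assms(1,2) compact_Hausdorff_or_regular_imp_normal_space normal_imp_completely_regular_space
    by blast
  moreover have "closedin X {y}"
    using assms(2,4) by (meson Hausdorff_imp_t1_space closedin_t1_singleton)
  ultimately obtain F where "continuous_map X euclideanreal F" "F x = 0" "F ` {y} \<subseteq> {1}"
    using assms(3,5) unfolding completely_regular_space_alt by blast
  then show ?thesis using that by simp
qed

definition product_action :: "'i set \<Rightarrow> ('i \<Rightarrow> 'g \<Rightarrow> 'x \<Rightarrow> 'x) \<Rightarrow> 'g \<Rightarrow> ('i \<Rightarrow> 'x) \<Rightarrow> 'i \<Rightarrow> 'x" where
  "product_action I act g x = (\<lambda>i\<in>I. act i g (x i))"

lemma compact_system_product:
  fixes act :: "'i \<Rightarrow> 'g::topological_group_add \<Rightarrow> 'x \<Rightarrow> 'x"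
  assumes X: "\<And>i. i \<in> I \<Longrightarrow> compact_system (X i) (act i)"
  shows "compact_system (product_topology X I) (product_action I act)"
proof -
  note c = compact_systemD[OF X]
  have "compact_space (product_topology X I)" using c(1) by (simp add: compact_space_product_topology)
  moreover have "Hausdorff_space (product_topology X I)"
    using c(2) by (simp add: Hausdorff_space_product_topology)
  moreover have "continuous_map (prod_topology euclidean (product_topology X I)) (product_topology X I)
      (\<lambda>(g, x). product_action I act g x)"
  proof -
    have "continuous_map (prod_topology euclidean (product_topology X I)) (X i)
        (\<lambda>p. act i (fst p) (snd p i))" if i: "i \<in> I" for i
    proof -
      have "continuous_map (prod_topology euclidean (product_topology X I)) (prod_topology euclidean (X i))
          (\<lambda>p. (fst p, snd p i))"
        by (intro continuous_map_pairedI continuous_map_fst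
            continuous_map_compose[OF continuous_map_snd continuous_map_product_projection[OF i],
              unfolded o_def])
      from continuous_map_compose[OF this c(3)[OF i]] show ?thesis
        by (simp add: o_def case_prod_unfold)
    qed
    then show ?thesis
      unfolding continuous_map_componentwise by (auto simp: product_action_def case_prod_unfold)
  qed
  moreover have "product_action I act 0 x = x" if "x \<in> topspace (product_topology X I)" for x
    using c(4) that by (auto simp: product_action_def PiE_iff extensional_def)
  moreover have "product_action I act (g + h) x = product_action I act g (product_action I act h x)"
    if "x \<in> topspace (product_topology X I)" for g h x
    using c(5) that by (auto simp: product_action_def PiE_iff)
  ultimately show ?thesis unfolding compact_system_def by blast
qed

text \<open>
  The functions that depend on one coordinate separate the points of the product, and their
  fragmentation on a set \<open>A\<close> is fragmentation in the factor on the projection of \<open>A\<close>.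
\<close>

lemma HNS_product:
  fixes act :: "'i \<Rightarrow> 'g::topological_group_add \<Rightarrow> 'x \<Rightarrow> 'x"
  assumes X: "\<And>i. i \<in> I \<Longrightarrow> compact_system (X i) (act i)"
    and hns: "\<And>i. i \<in> I \<Longrightarrow> HNS (X i) (act i)"
  shows "HNS (product_topology X I) (product_action I act)"
proof -
  let ?P = "product_topology X I"
  define \<F> where "\<F> = {\<lambda>x. F (x i) | i F. i \<in> I \<and> continuous_map (X i) euclideanreal F}"
  show ?thesis
  proof (rule HNS_if_separating_orbit_fragmented[of _ _ \<F>])
    show "compact_system ?P (product_action I act)" using X by (rule compact_system_product)
  next
    fix F assume "F \<in> \<F>"
    then obtain i f where i: "i \<in> I" and f: "continuous_map (X i) euclideanreal f"
      and F: "F = (\<lambda>x. f (x i))"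
      unfolding \<F>_def by blast
    have proj: "continuous_map ?P (X i) (\<lambda>x. x i)"
      by (rule continuous_map_product_projection[OF i])
    from continuous_map_compose[OF this f] show "continuous_map ?P euclideanreal F"
      by (simp add: o_def F)
    show "orbit_fragmented ?P (product_action I act) F"
      unfolding orbit_fragmented_def
    proof (intro allI impI)
      fix A and e :: real assume A: "A \<subseteq> topspace ?P \<and> A \<noteq> {} \<and> e > 0"
      let ?A = "(\<lambda>x. x i) ` A"
      have "?A \<subseteq> topspace (X i)" "?A \<noteq> {}" "e > 0" using A i by auto
      then obtain U where U: "openin (X i) U" "U \<inter> ?A \<noteq> {}"
        "\<And>g x y. x \<in> U \<inter> ?A \<Longrightarrow> y \<in> U \<inter> ?A \<Longrightarrow> \<bar>f (act i g x) - f (act i g y)\<bar> < e"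
        using orbit_fragmentedE[OF HNS_imp_orbit_fragmented[OF X[OF i] hns[OF i] f]] by metis
      let ?U = "{x \<in> topspace ?P. x i \<in> U}"
      have "openin ?P ?U" by (rule openin_continuous_map_preimage[OF proj U(1)])
      moreover have "?U \<inter> A \<noteq> {}" using U(2) A by blast
      moreover have "\<bar>F (product_action I act g x) - F (product_action I act g y)\<bar> < e"
        if "x \<in> ?U \<inter> A" "y \<in> ?U \<inter> A" for g x y
        using that U(3)[of "x i" "y i" g] i by (auto simp: F product_action_def)
      ultimately show "\<exists>U. openin ?P U \<and> U \<inter> A \<noteq> {} \<and> (\<forall>g. \<forall>x\<in>U \<inter> A. \<forall>y\<in>U \<inter> A.
          \<bar>F (product_action I act g x) - F (product_action I act g y)\<bar> < e)"
        by blast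
    qed
  next
    fix x y assume xy: "x \<in> topspace ?P" "y \<in> topspace ?P" "x \<noteq> y"
    then obtain i where i: "i \<in> I" "x i \<noteq> y i"
      by (metis PiE_ext topspace_product_topology)
    moreover have "x i \<in> topspace (X i)" "y i \<in> topspace (X i)" using xy i by auto
    ultimately obtain f where f: "continuous_map (X i) euclideanreal f" "f (x i) \<noteq> f (y i)"
      using compact_Hausdorff_separating_function compact_systemD(1,2)[OF X] by metis
    have "(\<lambda>x. f (x i)) \<in> \<F>" unfolding \<F>_def using i(1) f(1) by (intro CollectI exI conjI) auto
    then show "\<exists>F\<in>\<F>. F x \<noteq> F y" by (rule rev_bexI) (rule f(2))
  qed
qed

text \<open>
  The product over all Asplund functions of systems that represent them. One base point for all
  functions is what allows sums to be formed and finitely many functions to be treated at once.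
\<close>

lemma Asp_universal_system:
  obtains X :: "(('g::topological_group_add \<Rightarrow> real) \<Rightarrow> 'g set set) topology"
    and act x\<^sub>0 and F :: "('g \<Rightarrow> real) \<Rightarrow> _ \<Rightarrow> real"
  where "compact_system X act" "HNS X act" "x\<^sub>0 \<in> topspace X"
    "\<And>f. f \<in> Asp \<Longrightarrow> continuous_map X euclideanreal (F f)"
    "\<And>f g. f \<in> Asp \<Longrightarrow> f g = F f (act g x\<^sub>0)"
proof -
  have "\<forall>f\<in>Asp :: ('g \<Rightarrow> real) set. \<exists>(X :: 'g set set topology) act F x\<^sub>0.
      compact_system X act \<and> HNS X act \<and> continuous_map X euclideanreal F \<and>
      x\<^sub>0 \<in> topspace X \<and> (\<forall>g. f g = F (act g x\<^sub>0))"
    unfolding Asp_def by blast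
  then obtain X :: "('g \<Rightarrow> real) \<Rightarrow> 'g set set topology" and act F x\<^sub>0 where
    *: "\<And>f. f \<in> Asp \<Longrightarrow> compact_system (X f) (act f) \<and> HNS (X f) (act f) \<and>
      continuous_map (X f) euclideanreal (F f) \<and> x\<^sub>0 f \<in> topspace (X f) \<and>
      (\<forall>g. f g = F f (act f g (x\<^sub>0 f)))"
    unfolding bchoice_iff by (elim exE) (rule that, erule bspec)
  let ?P = "product_topology X Asp"
  have "compact_system ?P (product_action Asp act)" using * by (simp add: compact_system_product)
  moreover have "HNS ?P (product_action Asp act)" using * by (simp add: HNS_product)
  moreover have "restrict x\<^sub>0 Asp \<in> topspace ?P" using * by auto
  moreover have "continuous_map ?P euclideanreal (\<lambda>x. F f (x f))" if "f \<in> Asp" for f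
  proof -
    have "continuous_map ?P (X f) (\<lambda>x. x f)" by (rule continuous_map_product_projection[OF that])
    then have "continuous_map ?P euclideanreal (F f \<circ> (\<lambda>x. x f))"
      using * that by (intro continuous_map_compose) auto
    then show ?thesis by (simp add: o_def)
  qed
  moreover have "f g = F f (product_action Asp act g (restrict x\<^sub>0 Asp) f)" if "f \<in> Asp" for f g
    using * that by (simp add: product_action_def)
  ultimately show ?thesis by (rule that)
qed

lemma invariant_subspace_Asp:
  "invariant_subspace (Asp :: ('g::topological_group_add \<Rightarrow> real) set)"
proof -
  obtain X :: "(('g \<Rightarrow> real) \<Rightarrow> 'g set set) topology"
    and act x\<^sub>0 and F :: "('g \<Rightarrow> real) \<Rightarrow> _ \<Rightarrow> real"
    where X: "compact_system X act" "HNS X act" "x\<^sub>0 \<in> topspace X"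
    and F: "\<And>f. f \<in> Asp \<Longrightarrow> continuous_map X euclideanreal (F f)"
      "\<And>f g. f \<in> Asp \<Longrightarrow> f g = F f (act g x\<^sub>0)"
    using Asp_universal_system by blast
  have I: "f \<in> Asp" if "continuous_map X euclideanreal H" "\<And>g. f g = H (act g x\<^sub>0)" for f H
  proof -
    have "f = (\<lambda>g. H (act g x\<^sub>0))" using that(2) by blast
    then show ?thesis using Asp_I[OF X(1,2) that(1) X(3)] by simp
  qed
  show ?thesis
    unfolding invariant_subspace_def
  proof (intro conjI ballI allI)
    fix f :: "'g \<Rightarrow> real" assume "f \<in> Asp"
    then show "bounded (range f)" unfolding Asp_def by blast
  next
    fix c show "(\<lambda>_::'g. c) \<in> Asp" by (rule I[of "\<lambda>_. c"]) simp_all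
  next
    fix f h :: "'g \<Rightarrow> real" assume f: "f \<in> Asp" and h: "h \<in> Asp"
    show "(\<lambda>x. f x + h x) \<in> Asp"
      by (rule I[of "\<lambda>x. F f x + F h x"]) (auto simp: F(2)[OF f] F(2)[OF h] intro: continuous_map_add F f h)
  next
    fix c and f :: "'g \<Rightarrow> real" assume f: "f \<in> Asp"
    show "(\<lambda>x. c * f x) \<in> Asp"
      by (rule I[of "\<lambda>x. c * F f x"]) (auto simp: F(2)[OF f] intro: continuous_map_real_mult_left F f)
  next
    fix g and f :: "'g \<Rightarrow> real" assume f: "f \<in> Asp"
    show "left_translate g f \<in> Asp"
    proof (rule I)
      show "continuous_map X euclideanreal (F f \<circ> act g)"
        by (rule continuous_map_compose[OF compact_system_continuous(1)[OF X(1)] F(1)[OF f]])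
      show "left_translate g f h = (F f \<circ> act g) (act h x\<^sub>0)" for h
        using F(2)[OF f, of "g + h"] compact_systemD(5)[OF X(1,3)] by (simp add: left_translate_def)
    qed
  qed
qed

section \<open>Minimal subsystems and averages over minimal covers\<close>

definition minimal_subsystem :: "'x topology \<Rightarrow> ('g \<Rightarrow> 'x \<Rightarrow> 'x) \<Rightarrow> 'x set \<Rightarrow> bool" where
  "minimal_subsystem X act M \<longleftrightarrow>
     closedin X M \<and> M \<noteq> {} \<and> invariant_set act M \<and>
     (\<forall>N. closedin X N \<and> N \<noteq> {} \<and> invariant_set act N \<and> N \<subseteq> M \<longrightarrow> N = M)"

text \<open>
  Zorn's lemma for the open sets \<open>V\<close> whose complements \<open>Y - V\<close> are nonempty and invariant;
  compactness of \<open>Y\<close> keeps the union of a chain from covering \<open>Y\<close>.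
\<close>

lemma minimal_subsystem_exists:
  assumes X: "compact_space X" and Y: "closedin X Y" "Y \<noteq> {}" "invariant_set act Y"
  obtains M where "minimal_subsystem X act M" "M \<subseteq> Y"
proof -
  define \<V> where "\<V> = {V. openin X V \<and> Y - V \<noteq> {} \<and> invariant_set act (Y - V)}"
  have "{} \<in> \<V>" using Y unfolding \<V>_def by auto
  moreover have "\<Union>\<C> \<in> \<V>" if \<C>: "\<C> \<noteq> {}" "subset.chain \<V> \<C>" for \<C>
  proof -
    have \<C>\<V>: "\<C> \<subseteq> \<V>" using \<C>(2) by (simp add: subset_chain_def)
    have op: "openin X V" if "V \<in> \<C>" for V using \<C>\<V> that unfolding \<V>_def by blast
    have "Y - \<Union>\<C> \<noteq> {}"
    proof
      assume "Y - \<Union>\<C> = {}"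
      then have "Y \<subseteq> \<Union>\<C>" by blast
      then have "\<exists>\<D>. finite \<D> \<and> \<D> \<subseteq> \<C> \<and> Y \<subseteq> \<Union>\<D>"
        using op by (intro compactinD[OF closedin_compact_space[OF X Y(1)]])
      then obtain \<D> where \<D>: "finite \<D>" "\<D> \<subseteq> \<C>" "Y \<subseteq> \<Union>\<D>" by blast
      have "\<D> \<noteq> {}"
      proof
        assume "\<D> = {}"
        then show False using \<D>(3) Y(2) by simp
      qed
      moreover have "subset.chain \<V> \<D>"
        unfolding subset_chain_def
      proof (intro conjI ballI)
        show "\<D> \<subseteq> \<V>" using \<D>(2) \<C>\<V> by (rule subset_trans)
        fix U V assume "U \<in> \<D>" "V \<in> \<D>"
        then have "U \<in> \<C>" "V \<in> \<C>" using \<D>(2) by (simp_all add: subsetD)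
        then show "U \<subseteq> V \<or> V \<subseteq> U" using \<C>(2) by (simp add: subset_chain_def)
      qed
      ultimately have "\<Union>\<D> \<in> \<D>" using \<D>(1) by (intro Union_in_chain)
      then have "\<Union>\<D> \<in> \<V>" using \<D>(2) \<C>\<V> by blast
      then have "Y - \<Union>\<D> \<noteq> {}" unfolding \<V>_def by simp
      then show False using \<D>(3) by blast
    qed
    moreover have "invariant_set act (Y - \<Union>\<C>)"
      unfolding invariant_set_def
    proof (intro allI ballI)
      fix g y assume y: "y \<in> Y - \<Union>\<C>"
      have "act g y \<in> Y - V" if "V \<in> \<C>" for V
      proof -
        have "invariant_set act (Y - V)" using \<C>\<V> that unfolding \<V>_def by blast
        moreover have "y \<in> Y - V" using y that by blast
        ultimately show ?thesis unfolding invariant_set_def by blast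
      qed
      then show "act g y \<in> Y - \<Union>\<C>" using \<C>(1) by blast
    qed
    moreover have "openin X (\<Union>\<C>)" using op by (rule openin_Union)
    ultimately show ?thesis unfolding \<V>_def by (intro CollectI conjI)
  qed
  ultimately have "\<exists>V\<in>\<V>. \<forall>W\<in>\<V>. V \<subseteq> W \<longrightarrow> W = V" by (intro subset_Zorn_nonempty) auto
  then obtain V where V: "V \<in> \<V>" "\<And>W. W \<in> \<V> \<Longrightarrow> V \<subseteq> W \<Longrightarrow> W = V"
    by blast
  have "N = Y - V"
    if N: "closedin X N" "N \<noteq> {}" "invariant_set act N" "N \<subseteq> Y - V" for N
  proof -
    let ?W = "topspace X - N"
    have "Y - ?W = N" using N(4) closedin_subset[OF Y(1)] by blast
    then have "?W \<in> \<V>" using N unfolding \<V>_def by auto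
    moreover have "V \<subseteq> ?W"
      using N(4) V(1) openin_subset unfolding \<V>_def by blast
    ultimately have "?W = V" by (rule V(2))
    then show "N = Y - V" using \<open>Y - ?W = N\<close> by simp
  qed
  then have "minimal_subsystem X act (Y - V)"
    using V(1) Y(1) unfolding minimal_subsystem_def \<V>_def by (auto intro: closedin_diff)
  then show ?thesis using that by blast
qed

text \<open>
  Listing both families in decreasing order, the hypothesis says that the k-th value of \<open>u\<close> is at
  most the k-th value of \<open>v\<close>. The induction removes a largest value on both sides.
\<close>

lemma sum_le_if_level_counts_le:
  fixes u :: "'a \<Rightarrow> real" and v :: "'b \<Rightarrow> real"
  assumes "finite A" "finite B" "card A = card B"
    and "\<And>t. card {i \<in> A. t \<le> u i} \<le> card {j \<in> B. t \<le> v j}"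
  shows "sum u A \<le> sum v B"
  using assms
proof (induction "card A" arbitrary: A B)
  case 0
  then show ?case by simp
next
  case (Suc n)
  have "A \<noteq> {}" "B \<noteq> {}" using Suc.hyps(2) Suc.prems(3) by auto
  then obtain a b where a: "a \<in> A" "\<And>i. i \<in> A \<Longrightarrow> u i \<le> u a"
      and b: "b \<in> B" "\<And>j. j \<in> B \<Longrightarrow> v j \<le> v b"
    using obtains_MAX[OF Suc.prems(1)] obtains_MAX[OF Suc.prems(2)]
    by (metis Max_ge Suc.prems(1,2) finite_imageI imageI)
  have "{i \<in> A. u a \<le> u i} \<noteq> {}" using a(1) by blast
  then have "card {i \<in> A. u a \<le> u i} > 0" using Suc.prems(1) by (simp add: card_gt_0_iff)
  then have "card {j \<in> B. u a \<le> v j} > 0" using Suc.prems(4)[of "u a"] by linarith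
  then obtain j where "j \<in> B" "u a \<le> v j" by (auto simp: card_gt_0_iff)
  then have ab: "u a \<le> v b" using b(2) by force
  have "sum u (A - {a}) \<le> sum v (B - {b})"
  proof (rule Suc.hyps(1))
    show "n = card (A - {a})" "card (A - {a}) = card (B - {b})"
      using Suc.hyps(2) Suc.prems(1-3) a(1) b(1) by auto
    show "finite (A - {a})" "finite (B - {b})" using Suc.prems by auto
    fix t
    show "card {i \<in> A - {a}. t \<le> u i} \<le> card {j \<in> B - {b}. t \<le> v j}"
    proof (cases "t \<le> u a")
      case True
      have "{i \<in> A - {a}. t \<le> u i} = {i \<in> A. t \<le> u i} - {a}"
        "{j \<in> B - {b}. t \<le> v j} = {j \<in> B. t \<le> v j} - {b}" by auto
      moreover have "a \<in> {i \<in> A. t \<le> u i}" "b \<in> {j \<in> B. t \<le> v j}" using True ab a b by auto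
      ultimately have "card {i \<in> A - {a}. t \<le> u i} = card {i \<in> A. t \<le> u i} - 1"
        "card {j \<in> B - {b}. t \<le> v j} = card {j \<in> B. t \<le> v j} - 1"
        by (simp_all only: card_Diff_singleton)
      then show ?thesis using Suc.prems(4)[of t] by linarith
    next
      case False
      then have empty: "{i \<in> A - {a}. t \<le> u i} = {}" using a(2) by force
      show ?thesis unfolding empty by simp
    qed
  qed
  then show ?case using ab a(1) b(1) Suc.prems(1,2) by (simp add: sum.remove[of A a] sum.remove[of B b])
qed

definition orbit_small :: "('g \<Rightarrow> 'x \<Rightarrow> 'x) \<Rightarrow> ('x \<Rightarrow> real) set \<Rightarrow> real \<Rightarrow> 'x set \<Rightarrow> bool" where
  "orbit_small act \<Phi> e A \<longleftrightarrow> (\<forall>F\<in>\<Phi>. \<forall>g. \<forall>x\<in>A. \<forall>y\<in>A. \<bar>F (act g x) - F (act g y)\<bar> \<le> e)"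

text \<open>
  Let \<open>\<A>\<close> be a cover of \<open>M\<close> by small sets with the least number of members and let \<open>a A\<close> be a point of
  \<open>A\<close>. In \<open>\<A>\<close>, replace the members \<open>A\<close> with \<open>F (a A) \<ge> t\<close> by the translates \<open>g B\<close> of those members \<open>B\<close>
  with \<open>F (g (a B)) \<ge> t - 2 e\<close>. The result still covers \<open>M\<close>: when \<open>A\<close> and \<open>g B\<close> share a point, \<open>F\<close>
  differs by at most \<open>2 e\<close> between \<open>a A\<close> and \<open>g (a B)\<close>. As \<open>\<A>\<close> is a least cover, at least as many members
  were inserted as removed. This compares the numbers of points above every level \<open>t\<close>, hence the
  sums. It does the work of Hall's marriage theorem, which would match the two covers.
\<close>

lemma minimal_cover_almost_invariant:
  fixes act :: "'g::group_add \<Rightarrow> 'x \<Rightarrow> 'x"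
  assumes M: "M \<noteq> {}" "\<And>g x. x \<in> M \<Longrightarrow> act g x \<in> M"
    and act: "\<And>x. x \<in> M \<Longrightarrow> act 0 x = x" "\<And>g h x. x \<in> M \<Longrightarrow> act (g + h) x = act g (act h x)"
    and cover: "finite \<C>" "\<forall>C\<in>\<C>. C \<subseteq> M \<and> orbit_small act \<Phi> e C" "M \<subseteq> \<Union>\<C>"
  obtains \<A> :: "'x set set" and a where "finite \<A>" "\<A> \<noteq> {}" "\<forall>A\<in>\<A>. a A \<in> M"
    "\<forall>F\<in>\<Phi>. \<forall>g. \<bar>(\<Sum>A\<in>\<A>. F (act g (a A))) - (\<Sum>A\<in>\<A>. F (a A))\<bar> \<le> 2 * e * card \<A>"
proof -
  define small_cover where "small_cover \<A> \<longleftrightarrow>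
      finite \<A> \<and> (\<forall>A\<in>\<A>. A \<subseteq> M \<and> orbit_small act \<Phi> e A) \<and> M \<subseteq> \<Union>\<A>" for \<A>
  have "small_cover \<C>" using cover unfolding small_cover_def by blast
  then obtain \<A> where \<A>: "small_cover \<A>" and least: "\<And>\<B>. small_cover \<B> \<Longrightarrow> card \<A> \<le> card \<B>"
    using ex_has_least_nat[of small_cover \<C> card] by blast
  have fin: "finite \<A>" and sub: "\<And>A. A \<in> \<A> \<Longrightarrow> A \<subseteq> M"
    and small: "\<And>A. A \<in> \<A> \<Longrightarrow> orbit_small act \<Phi> e A" and cov: "M \<subseteq> \<Union>\<A>"
    using \<A> unfolding small_cover_def by auto
  have smallD: "\<bar>F (act g x) - F (act g y)\<bar> \<le> e"
    if "A \<in> \<A>" "F \<in> \<Phi>" "x \<in> A" "y \<in> A" for A F g x y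
    using small that unfolding orbit_small_def by blast
  have "\<A> \<noteq> {}" using M(1) cov by auto
  have "{} \<notin> \<A>"
  proof
    assume "{} \<in> \<A>"
    moreover have "small_cover (\<A> - {{}})" using \<A> unfolding small_cover_def by auto
    ultimately show False using least[of "\<A> - {{}}"] fin card_Diff1_less by fastforce
  qed
  define a where "a A = (SOME x. x \<in> A)" for A :: "'x set"
  have a: "a A \<in> A" if "A \<in> \<A>" for A
    unfolding a_def using \<open>{} \<notin> \<A>\<close> that by (metis some_in_eq)
  have inv: "act g (act (- g) x) = x" if "x \<in> M" for g x
    using act(2)[OF that, of g "- g"] act(1)[OF that] by simp
  \<comment> \<open>The sign \<open>\<sigma>\<close> gives both inequalities for the sums: smallness of a set is the same for \<open>F\<close> and \<open>- F\<close>.\<close>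
  have one_sided: "(\<Sum>A\<in>\<A>. \<sigma> * F (a A)) \<le> (\<Sum>A\<in>\<A>. \<sigma> * F (act g (a A)) + 2 * e)"
    if F: "F \<in> \<Phi>" and \<sigma>: "\<bar>\<sigma>\<bar> = 1" for F g and \<sigma> :: real
  proof (rule sum_le_if_level_counts_le[OF fin fin refl], rule ccontr)
    fix t
    let ?I = "{A \<in> \<A>. t \<le> \<sigma> * F (a A)}" and ?J = "{A \<in> \<A>. t \<le> \<sigma> * F (act g (a A)) + 2 * e}"
    assume "\<not> card ?I \<le> card ?J"
    then have less: "card ?J < card ?I" by simp
    define \<B> where "\<B> = (\<A> - ?I) \<union> (\<lambda>B. act g ` B) ` ?J"
    have "card \<B> \<le> card (\<A> - ?I) + card ?J"
      unfolding \<B>_def using fin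
      by (intro order_trans[OF card_Un_le] add_left_mono card_image_le) auto
    also have "\<dots> < card \<A>"
      using less fin card_mono[OF fin, of ?I] by (subst card_Diff_subset) auto
    finally have "card \<B> < card \<A>" .
    moreover have "small_cover \<B>"
      unfolding small_cover_def
    proof (intro conjI ballI subsetI)
      show "finite \<B>" unfolding \<B>_def using fin by simp
    next
      fix B x assume "B \<in> \<B>" "x \<in> B"
      then show "x \<in> M" unfolding \<B>_def using sub M(2) by blast
    next
      fix B assume "B \<in> \<B>"
      then consider "B \<in> \<A>" | C where "C \<in> \<A>" "B = act g ` C" unfolding \<B>_def by blast
      then show "orbit_small act \<Phi> e B"
      proof cases
        case 2
        have "\<bar>F (act h (act g x)) - F (act h (act g y))\<bar> \<le> e"
          if "F \<in> \<Phi>" "x \<in> C" "y \<in> C" for F h x y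
          using smallD[OF 2(1) that(1-3), of "h + g"] act(2) that(2,3) sub[OF 2(1)] by (simp add: subset_iff)
        then show ?thesis unfolding orbit_small_def 2(2) by blast
      qed (rule small)
    next
      fix x assume x: "x \<in> M"
      then obtain A where A: "A \<in> \<A>" "x \<in> A" using cov by blast
      show "x \<in> \<Union>\<B>"
      proof (cases "A \<in> ?I")
        case False
        then show ?thesis using A unfolding \<B>_def by blast
      next
        case True
        obtain B where B: "B \<in> \<A>" "act (- g) x \<in> B" using cov M(2)[OF x] by blast
        have "\<bar>F (a A) - F x\<bar> \<le> e"
          using smallD[OF A(1) F a[OF A(1)] A(2), of 0] act(1)[OF x]
            act(1)[OF subsetD[OF sub[OF A(1)] a[OF A(1)]]] by simp
        moreover have "\<bar>F x - F (act g (a B))\<bar> \<le> e"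
          using smallD[OF B(1) F B(2) a[OF B(1)], of g] inv[OF x] by simp
        ultimately have "\<sigma> * F (a A) \<le> \<sigma> * F (act g (a B)) + 2 * e"
          using \<sigma> by (cases "\<sigma> \<ge> 0") auto
        then have "B \<in> ?J" using True B(1) by auto
        moreover have "x \<in> act g ` B" using B(2) inv[OF x, of g] by (metis imageI)
        ultimately show ?thesis unfolding \<B>_def by blast
      qed
    qed
    ultimately show False using least by fastforce
  qed
  show ?thesis
  proof (rule that[OF fin \<open>\<A> \<noteq> {}\<close>])
    show "\<forall>A\<in>\<A>. a A \<in> M" using a sub by blast
    have "\<bar>(\<Sum>A\<in>\<A>. F (act g (a A))) - (\<Sum>A\<in>\<A>. F (a A))\<bar> \<le> 2 * e * card \<A>"
      if "F \<in> \<Phi>" for F g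
      using one_sided[OF that, of 1 g] one_sided[OF that, of "-1" g]
      by (simp add: sum.distrib sum_subtractf sum_negf abs_le_iff algebra_simps)
    then show "\<forall>F\<in>\<Phi>. \<forall>g. \<bar>(\<Sum>A\<in>\<A>. F (act g (a A))) - (\<Sum>A\<in>\<A>. F (a A))\<bar> \<le> 2 * e * card \<A>"
      by blast
  qed
qed

text \<open>
  Fragmentation gives one small relatively open piece of \<open>M\<close>. The points of \<open>M\<close> whose orbits avoid it
  form a closed invariant proper subset, which is empty by minimality. So the preimages of the
  piece under the group elements cover \<open>M\<close>, and preimages of a small set are small.
\<close>

lemma minimal_HNS_small_cover:
  fixes act :: "'g::topological_group_add \<Rightarrow> 'x \<Rightarrow> 'x"
  assumes X: "compact_system X act"
    and \<Phi>: "finite \<Phi>" "\<And>F. F \<in> \<Phi> \<Longrightarrow> orbit_fragmented X act F" and e: "e > 0"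
    and minimal: "minimal_subsystem X act M"
  obtains \<C> where "finite \<C>" "\<forall>C\<in>\<C>. C \<subseteq> M \<and> orbit_small act \<Phi> e C" "M \<subseteq> \<Union>\<C>"
proof -
  note act = compact_systemD(4,5)[OF X]
  have M: "closedin X M" "M \<noteq> {}" "invariant_set act M"
    using minimal unfolding minimal_subsystem_def by blast+
  have MX: "M \<subseteq> topspace X" by (rule closedin_subset[OF M(1)])
  have inM: "act g x \<in> M" if "x \<in> M" for g x using M(3) that unfolding invariant_set_def by blast
  obtain U where U: "openin X U" "U \<inter> M \<noteq> {}"
    "\<And>F g x y. F \<in> \<Phi> \<Longrightarrow> x \<in> U \<inter> M \<Longrightarrow> y \<in> U \<inter> M \<Longrightarrow> \<bar>F (act g x) - F (act g y)\<bar> < e"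
    using orbit_fragmented_finite[OF \<Phi> MX M(2) e] by metis
  define V where "V h = {x \<in> topspace X. act h x \<in> U}" for h
  have V: "openin X (V h)" for h
    unfolding V_def by (rule openin_continuous_map_preimage[OF compact_system_continuous(1)[OF X] U(1)])
  define N where "N = M - \<Union>(range V)"
  have "N = {}"
  proof (rule ccontr)
    assume "N \<noteq> {}"
    moreover have "closedin X N" unfolding N_def using M(1) V by (intro closedin_diff) auto
    moreover have "invariant_set act N"
      unfolding invariant_set_def
    proof (intro allI ballI)
      fix g x assume x: "x \<in> N"
      then have xM: "x \<in> M" "x \<in> topspace X" using MX unfolding N_def by auto
      have "act h (act g x) \<notin> U" for h
      proof -
        have "x \<notin> V (h + g)" using x unfolding N_def by blast
        then show ?thesis using xM(2) act(2)[OF xM(2), of h g] by (simp add: V_def)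
      qed
      then show "act g x \<in> N" using inM[OF xM(1)] unfolding N_def V_def by blast
    qed
    moreover have "N \<subseteq> M" unfolding N_def by blast
    ultimately have "N = M" using minimal unfolding minimal_subsystem_def by blast
    moreover obtain x where x: "x \<in> U" "x \<in> M" using U(2) by blast
    then have "x \<in> V 0" using MX act(1) unfolding V_def by auto
    ultimately show False using x(2) unfolding N_def by blast
  qed
  then have "M \<subseteq> \<Union>(range V)" unfolding N_def by blast
  moreover have "compactin X M"
    using compact_systemD(1)[OF X] M(1) by (rule closedin_compact_space)
  ultimately obtain \<U> where \<U>: "finite \<U>" "\<U> \<subseteq> range V" "M \<subseteq> \<Union>\<U>"
    using compactinD[of X M "range V"] V by blast
  show ?thesis
  proof (rule that[of "(\<lambda>U. U \<inter> M) ` \<U>"])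
    show "finite ((\<lambda>U. U \<inter> M) ` \<U>)" "M \<subseteq> \<Union>((\<lambda>U. U \<inter> M) ` \<U>)" using \<U> by auto
    show "\<forall>C\<in>(\<lambda>U. U \<inter> M) ` \<U>. C \<subseteq> M \<and> orbit_small act \<Phi> e C"
    proof
      fix C assume "C \<in> (\<lambda>U. U \<inter> M) ` \<U>"
      then obtain h where h: "C = V h \<inter> M" using \<U>(2) by blast
      have "\<bar>F (act g x) - F (act g y)\<bar> \<le> e" if F: "F \<in> \<Phi>" and xy: "x \<in> C" "y \<in> C" for F g x y
      proof -
        have "act h x \<in> U \<inter> M" "act h y \<in> U \<inter> M" using xy inM unfolding h V_def by auto
        from U(3)[OF F this, of "g - h"] show ?thesis
          using act(2)[of x "g - h" h] act(2)[of y "g - h" h] xy unfolding h V_def by simp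
      qed
      then show "C \<subseteq> M \<and> orbit_small act \<Phi> e C" unfolding orbit_small_def h by blast
    qed
  qed
qed

lemma closure_of_finite_approximation:
  assumes a: "a \<in> X closure_of S" and fin: "finite \<H>"
    and cont: "\<And>H. H \<in> \<H> \<Longrightarrow> continuous_map X euclideanreal H" and e: "e > 0"
  obtains s where "s \<in> S" "\<forall>H\<in>\<H>. \<bar>H s - H a\<bar> < e"
proof -
  define U where "U = {x \<in> topspace X. (\<Sum>H\<in>\<H>. \<bar>H x - H a\<bar>) \<in> {..<e}}"
  have "continuous_map X euclideanreal (\<lambda>x. \<Sum>H\<in>\<H>. \<bar>H x - H a\<bar>)"
    using fin cont by (intro continuous_map_sum continuous_map_real_abs continuous_map_diff) auto
  then have "openin X U" unfolding U_def by (rule openin_continuous_map_preimage) simp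
  moreover have "a \<in> U" using a e unfolding U_def by (simp add: in_closure_of)
  ultimately obtain s where s: "s \<in> S" "s \<in> U" using a unfolding in_closure_of by blast
  have "\<bar>H s - H a\<bar> < e" if "H \<in> \<H>" for H
    using member_le_sum[OF that, of "\<lambda>H. \<bar>H s - H a\<bar>"] fin s(2) unfolding U_def by auto
  then show ?thesis using that s(1) by blast
qed

text \<open>
  The indices are the members of a least cover of a minimal subsystem inside the closure of the
  orbit of \<open>x\<^sub>0\<close>. Half of the error \<open>e\<close> comes from the invariance of the averages over the
  chosen points, the rest from moving these points into the orbit, before and after translation.
\<close>

lemma Asp_almost_invariant_averages:
  fixes \<Phi> :: "('g::topological_group_add \<Rightarrow> real) set"
  assumes \<Phi>: "finite \<Phi>" "\<Phi> \<subseteq> Asp" and K: "finite K" and e: "(e::real) > 0"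
  obtains I :: "(('g \<Rightarrow> real) \<Rightarrow> 'g set set) set set" and t where "finite I" "I \<noteq> {}"
    "\<forall>f\<in>\<Phi>. \<forall>g\<in>K. \<bar>(\<Sum>i\<in>I. f (g + t i)) - (\<Sum>i\<in>I. f (t i))\<bar> \<le> e * card I"
proof -
  obtain X :: "(('g \<Rightarrow> real) \<Rightarrow> 'g set set) topology"
    and act x\<^sub>0 and F :: "('g \<Rightarrow> real) \<Rightarrow> _ \<Rightarrow> real"
    where X: "compact_system X act" "HNS X act" "x\<^sub>0 \<in> topspace X"
    and F: "\<And>f. f \<in> Asp \<Longrightarrow> continuous_map X euclideanreal (F f)"
      "\<And>f g. f \<in> Asp \<Longrightarrow> f g = F f (act g x\<^sub>0)"
    using Asp_universal_system by blast
  note act = compact_systemD(4,5)[OF X(1)]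
  let ?O = "range (\<lambda>g. act g x\<^sub>0)"
  have "?O \<subseteq> topspace X" using compact_system_continuous(3)[OF X(1,3)] by auto
  then have "X closure_of ?O \<noteq> {}" using closure_of_subset[of ?O X] by auto
  then obtain M where minimal: "minimal_subsystem X act M" and MO: "M \<subseteq> X closure_of ?O"
    by (rule minimal_subsystem_exists[OF compact_systemD(1)[OF X(1)] closedin_closure_of _
          orbit_closure_invariant[OF X(1,3)]])
  have M: "closedin X M" "M \<noteq> {}" "invariant_set act M"
    using minimal unfolding minimal_subsystem_def by blast+
  have MX: "M \<subseteq> topspace X" by (rule closedin_subset[OF M(1)])
  have e4: "e / 4 > 0" using e by simp
  have frag: "orbit_fragmented X act H" if "H \<in> F ` \<Phi>" for H
    using that \<Phi>(2) HNS_imp_orbit_fragmented[OF X(1,2)] F(1) by blast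
  have fin: "finite (F ` \<Phi>)" using \<Phi>(1) by simp
  obtain \<C> where \<C>: "finite \<C>" "\<forall>C\<in>\<C>. C \<subseteq> M \<and> orbit_small act (F ` \<Phi>) (e / 4) C" "M \<subseteq> \<Union>\<C>"
    by (rule minimal_HNS_small_cover[OF X(1) fin frag e4 minimal])
  have Mact: "\<And>g x. x \<in> M \<Longrightarrow> act g x \<in> M" "\<And>x. x \<in> M \<Longrightarrow> act 0 x = x"
    "\<And>g h x. x \<in> M \<Longrightarrow> act (g + h) x = act g (act h x)"
    using M(3) act MX unfolding invariant_set_def by blast+
  obtain \<A> :: "(('g \<Rightarrow> real) \<Rightarrow> 'g set set) set set" and a
    where \<A>: "finite \<A>" "\<A> \<noteq> {}" "\<forall>A\<in>\<A>. a A \<in> M"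
    "\<forall>H\<in>F ` \<Phi>. \<forall>g.
        \<bar>(\<Sum>A\<in>\<A>. H (act g (a A))) - (\<Sum>A\<in>\<A>. H (a A))\<bar> \<le> 2 * (e / 4) * card \<A>"
    by (rule minimal_cover_almost_invariant[OF M(2) Mact \<C>])
  \<comment> \<open>The points \<open>a A\<close> are approximated by points of the orbit of \<open>x\<^sub>0\<close>, simultaneously for all
     functions and translations in question; \<open>0\<close> stands for the untranslated functions.\<close>
  define \<H> where "\<H> = (\<lambda>(f, g). F f \<circ> act g) ` (\<Phi> \<times> insert 0 K)"
  have "\<forall>A\<in>\<A>. \<exists>s. \<forall>H\<in>\<H>. \<bar>H (act s x\<^sub>0) - H (a A)\<bar> < e / 4"
  proof
    fix A assume A: "A \<in> \<A>"
    have "a A \<in> X closure_of ?O" using \<A>(3) A MO by blast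
    moreover have "finite \<H>" using \<Phi>(1) K unfolding \<H>_def by simp
    moreover have "continuous_map X euclideanreal H" if H: "H \<in> \<H>" for H
    proof -
      obtain f g where f: "f \<in> \<Phi>" and H: "H = F f \<circ> act g" using H unfolding \<H>_def by auto
      have "f \<in> Asp" using f \<Phi>(2) by blast
      then show ?thesis
        unfolding H by (rule continuous_map_compose[OF compact_system_continuous(1)[OF X(1)] F(1)])
    qed
    ultimately obtain y where "y \<in> ?O" "\<forall>H\<in>\<H>. \<bar>H y - H (a A)\<bar> < e / 4"
      using e4 by (rule closure_of_finite_approximation)
    then show "\<exists>s. \<forall>H\<in>\<H>. \<bar>H (act s x\<^sub>0) - H (a A)\<bar> < e / 4" by blast
  qed
  then obtain t where t: "\<forall>A\<in>\<A>. \<forall>H\<in>\<H>. \<bar>H (act (t A) x\<^sub>0) - H (a A)\<bar> < e / 4"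
    unfolding bchoice_iff by blast
  have near: "\<bar>(\<Sum>A\<in>\<A>. f (g + t A)) - (\<Sum>A\<in>\<A>. F f (act g (a A)))\<bar> \<le> e / 4 * card \<A>"
    if f: "f \<in> \<Phi>" and g: "g \<in> insert 0 K" for f g
  proof -
    have "\<bar>f (g + t A) - F f (act g (a A))\<bar> \<le> e / 4" if A: "A \<in> \<A>" for A
    proof -
      have "F f \<circ> act g \<in> \<H>" using f g unfolding \<H>_def by force
      from bspec[OF bspec[OF t A] this]
      have "\<bar>F f (act g (act (t A) x\<^sub>0)) - F f (act g (a A))\<bar> < e / 4" by simp
      moreover have "f (g + t A) = F f (act g (act (t A) x\<^sub>0))"
        using F(2)[of f "g + t A"] f \<Phi>(2) act(2)[OF X(3)] by auto
      ultimately show ?thesis by simp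
    qed
    then have "(\<Sum>A\<in>\<A>. \<bar>f (g + t A) - F f (act g (a A))\<bar>) \<le> (\<Sum>A\<in>\<A>. e / 4)" by (rule sum_mono)
    then show ?thesis
      using sum_abs[of "\<lambda>A. f (g + t A) - F f (act g (a A))" \<A>] by (simp add: sum_subtractf mult.commute)
  qed
  have "\<bar>(\<Sum>A\<in>\<A>. f (g + t A)) - (\<Sum>A\<in>\<A>. f (t A))\<bar> \<le> e * card \<A>"
    if f: "f \<in> \<Phi>" and g: "g \<in> K" for f g
  proof -
    have "(\<Sum>A\<in>\<A>. F f (act 0 (a A))) = (\<Sum>A\<in>\<A>. F f (a A))"
      using Mact(2) \<A>(3) by (intro sum.cong) auto
    then have "\<bar>(\<Sum>A\<in>\<A>. f (t A)) - (\<Sum>A\<in>\<A>. F f (a A))\<bar> * 4 \<le> e * card \<A>"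
      using near[OF f, of 0] by simp
    moreover have "\<bar>(\<Sum>A\<in>\<A>. f (g + t A)) - (\<Sum>A\<in>\<A>. F f (act g (a A)))\<bar> * 4 \<le> e * card \<A>"
      using near[OF f, of g] g by simp
    moreover have "\<bar>(\<Sum>A\<in>\<A>. F f (act g (a A))) - (\<Sum>A\<in>\<A>. F f (a A))\<bar> * 2 \<le> e * card \<A>"
      using \<A>(4) f by simp
    moreover have "\<bar>r - p\<bar> \<le> c" if "\<bar>p - q\<bar> * 4 \<le> c" "\<bar>r - s\<bar> * 4 \<le> c" "\<bar>s - q\<bar> * 2 \<le> c"
      for p q r s c :: real
      using that by (smt (verit))
    ultimately show ?thesis by blast
  qed
  then show ?thesis using that[OF \<A>(1,2)] by blast
qed

section \<open>Limits of means\<close>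

text \<open>
  The norm condition of a mean in pointwise form. In this form all conditions involve finitely
  many values of \<open>m\<close> at a time, so that they survive pointwise limits.
\<close>

definition sup_mean_on :: "('g \<Rightarrow> real) set \<Rightarrow> (('g \<Rightarrow> real) \<Rightarrow> real) \<Rightarrow> bool" where
  "sup_mean_on F m \<longleftrightarrow>
     (\<forall>f\<in>F. \<forall>h\<in>F. m (\<lambda>x. f x + h x) = m f + m h) \<and>
     (\<forall>c. \<forall>f\<in>F. m (\<lambda>x. c * f x) = c * m f) \<and>
     m (\<lambda>_. 1) = 1 \<and> (\<forall>f\<in>F. \<bar>m f\<bar> \<le> sup_norm f)"

lemma sup_mean_on_imp_mean_on:
  assumes F: "(\<lambda>_. 1) \<in> F" and m: "sup_mean_on F m"
  shows "mean_on F m"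
proof -
  have "functional_norm F m = 1"
    unfolding functional_norm_def
  proof (rule antisym)
    show "(SUP f\<in>{f \<in> F. sup_norm f \<le> 1}. ereal \<bar>m f\<bar>) \<le> 1"
      using m unfolding sup_mean_on_def by (intro SUP_least) force
    have "sup_norm (\<lambda>_::'a. 1) \<le> 1" by (simp add: sup_norm_def)
    then have "ereal \<bar>m (\<lambda>_. 1)\<bar> \<le> (SUP f\<in>{f \<in> F. sup_norm f \<le> 1}. ereal \<bar>m f\<bar>)"
      using F by (intro SUP_upper) simp
    then show "1 \<le> (SUP f\<in>{f \<in> F. sup_norm f \<le> 1}. ereal \<bar>m f\<bar>)"
      using m by (simp add: sup_mean_on_def one_ereal_def)
  qed
  then show ?thesis using m unfolding mean_on_def sup_mean_on_def by blast
qed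

lemma sup_mean_on_average:
  assumes I: "finite I" "I \<noteq> {}" and F: "\<And>f. f \<in> F \<Longrightarrow> bounded (range f)"
  shows "sup_mean_on F (\<lambda>f. (\<Sum>i\<in>I. f (t i)) / card I)"
proof -
  have c: "real (card I) > 0" using I by (simp add: card_gt_0_iff)
  have "\<bar>(\<Sum>i\<in>I. f (t i)) / card I\<bar> \<le> sup_norm f" if "f \<in> F" for f
  proof -
    have "bdd_above (range (\<lambda>x. \<bar>f x\<bar>))"
      using F[OF that] unfolding bounded_iff bdd_above_def by auto
    then have "\<bar>f x\<bar> \<le> sup_norm f" for x unfolding sup_norm_def by (rule cSUP_upper[OF UNIV_I])
    then have "(\<Sum>i\<in>I. \<bar>f (t i)\<bar>) \<le> (\<Sum>i\<in>I. sup_norm f)" by (intro sum_mono)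
    then have "\<bar>\<Sum>i\<in>I. f (t i)\<bar> \<le> (\<Sum>i\<in>I. sup_norm f)" by (rule order_trans[OF sum_abs])
    then have "\<bar>\<Sum>i\<in>I. f (t i)\<bar> \<le> card I * sup_norm f" by simp
    then show ?thesis using c by (simp add: field_simps)
  qed
  then show ?thesis
    using c unfolding sup_mean_on_def by (auto simp: sum.distrib add_divide_distrib sum_distrib_left)
qed

lemma sup_mean_on_cong:
  assumes F: "invariant_subspace F" and m: "sup_mean_on F m" and eq: "\<And>f. f \<in> F \<Longrightarrow> m' f = m f"
  shows "sup_mean_on F m'"
  using assms unfolding sup_mean_on_def invariant_subspace_def by simp

lemma closed_sup_means: "closed {m. sup_mean_on F m}"
proof -
  have c: "continuous_on UNIV (\<lambda>m :: ('a \<Rightarrow> real) \<Rightarrow> real. m f)" for f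
    by (rule continuous_on_product_coordinates)
  show ?thesis
    unfolding sup_mean_on_def Ball_def
    by (intro closed_Collect_conj closed_Collect_all closed_Collect_imp closed_Collect_eq
        closed_Collect_le continuous_intros c open_Collect_const)
qed

lemma compact_functionals_bounded_pointwise:
  fixes b :: "'a \<Rightarrow> real"
  shows "compact {m. \<forall>f. \<bar>m f\<bar> \<le> b f}"
proof -
  have "compactin (product_topology (\<lambda>_. euclidean) UNIV) (PiE UNIV (\<lambda>f. cball (0::real) (b f)))"
    by (simp add: compactin_PiE)
  moreover have "PiE UNIV (\<lambda>f. cball (0::real) (b f)) = {m. \<forall>f. \<bar>m f\<bar> \<le> b f}"
    by (auto simp: PiE_UNIV_domain)
  ultimately show ?thesis by (simp add: euclidean_product_topology)
qed

text \<open>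
  Almost invariance for one function, one group element and one error bound is a closed condition
  on means in the topology of pointwise convergence. The hypothesis is the finite intersection
  property of these conditions.
\<close>

lemma left_amenable_if_almost_invariant_means:
  fixes F :: "('g::plus \<Rightarrow> real) set"
  assumes F: "invariant_subspace F"
    and approx: "\<And>\<Phi> K e. finite \<Phi> \<Longrightarrow> \<Phi> \<subseteq> F \<Longrightarrow> finite K \<Longrightarrow> e > 0 \<Longrightarrow>
      \<exists>m. sup_mean_on F m \<and> (\<forall>f\<in>\<Phi>. \<forall>g\<in>K. \<bar>m (left_translate g f) - m f\<bar> \<le> e)"
  shows "left_amenable F"
proof -
  \<comment> \<open>Functionals are total, so they are set to \<open>0\<close> outside \<open>F\<close> to keep them in a compact set.\<close>
  define S where "S = {m :: ('g \<Rightarrow> real) \<Rightarrow> real. \<forall>f. \<bar>m f\<bar> \<le> (if f \<in> F then sup_norm f else 0)} \<inter>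
      {m. sup_mean_on F m}"
  define D where "D = (\<lambda>(f, g, e). {m :: ('g \<Rightarrow> real) \<Rightarrow> real. \<bar>m (left_translate g f) - m f\<bar> \<le> e})"
  define P where "P = F \<times> (UNIV :: 'g set) \<times> {0 :: real<..}"
  have "S \<inter> (\<Inter>p\<in>P. D p) \<noteq> {}"
  proof (rule compact_imp_fip_image)
    show "compact S"
      unfolding S_def
      by (intro compact_Int_closed compact_functionals_bounded_pointwise closed_sup_means)
    show "closed (D p)" for p
    proof -
      have c: "continuous_on UNIV (\<lambda>m :: ('g \<Rightarrow> real) \<Rightarrow> real. m f)" for f
        by (rule continuous_on_product_coordinates)
      show ?thesis unfolding D_def
        by (cases p) (auto intro!: closed_Collect_le continuous_intros c)
    qed
    fix Q assume Q: "finite Q" "Q \<subseteq> P"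
    define \<Phi> K e where "\<Phi> = fst ` Q" "K = (fst \<circ> snd) ` Q"
      "e = Min (insert 1 ((snd \<circ> snd) ` Q))"
    have "e > 0" using Q unfolding \<Phi>_K_e_def P_def by (subst Min_gr_iff) auto
    moreover have "finite \<Phi>" "\<Phi> \<subseteq> F" "finite K" using Q unfolding \<Phi>_K_e_def P_def by auto
    ultimately have "\<exists>m. sup_mean_on F m \<and> (\<forall>f\<in>\<Phi>. \<forall>g\<in>K. \<bar>m (left_translate g f) - m f\<bar> \<le> e)"
      by (intro approx)
    then obtain m where m: "sup_mean_on F m"
      "\<forall>f\<in>\<Phi>. \<forall>g\<in>K. \<bar>m (left_translate g f) - m f\<bar> \<le> e"
      by (elim exE conjE)
    define m' where "m' f = (if f \<in> F then m f else 0)" for f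
    have "sup_mean_on F m'" by (rule sup_mean_on_cong[OF F m(1)]) (simp add: m'_def)
    then have "m' \<in> S" unfolding S_def by (auto simp: sup_mean_on_def m'_def)
    moreover have "m' \<in> D q" if q: "q \<in> Q" for q
    proof -
      obtain f g d where fgd: "q = (f, g, d)" by (cases q)
      then have "f \<in> \<Phi>" "g \<in> K" "f \<in> F" "e \<le> d"
        using q Q unfolding \<Phi>_K_e_def P_def by (force intro: Min_le)+
      then show ?thesis
        using bspec[OF bspec[OF m(2)], of f g] F unfolding D_def fgd invariant_subspace_def by (simp add: m'_def)
    qed
    ultimately show "S \<inter> (\<Inter>q\<in>Q. D q) \<noteq> {}" by blast
  qed
  then obtain m where m: "m \<in> S" "\<And>p. p \<in> P \<Longrightarrow> m \<in> D p" by blast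
  have "m (left_translate g f) = m f" if f: "f \<in> F" for f g
  proof -
    have "\<bar>m (left_translate g f) - m f\<bar> \<le> 0 + e" if "e > 0" for e
      using m(2)[of "(f, g, e)"] f that unfolding P_def D_def by simp
    then have "\<bar>m (left_translate g f) - m f\<bar> \<le> 0" by (rule field_le_epsilon)
    then show ?thesis by simp
  qed
  moreover have "mean_on F m"
    using m(1) F sup_mean_on_imp_mean_on unfolding S_def invariant_subspace_def by blast
  ultimately show ?thesis using F unfolding left_amenable_def left_invariant_on_def by blast
qed

theorem proposition2p3:
  shows "left_amenable (Asp :: ('g::topological_group_add \<Rightarrow> real) set)"
proof (rule left_amenable_if_almost_invariant_means[OF invariant_subspace_Asp])
  fix \<Phi> :: "('g \<Rightarrow> real) set" and K :: "'g set" and e :: real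
  assume *: "finite \<Phi>" "\<Phi> \<subseteq> Asp" "finite K" "e > 0"
  obtain I :: "(('g \<Rightarrow> real) \<Rightarrow> 'g set set) set set" and t where I: "finite I" "I \<noteq> {}"
    and t: "\<forall>f\<in>\<Phi>. \<forall>g\<in>K. \<bar>(\<Sum>i\<in>I. f (g + t i)) - (\<Sum>i\<in>I. f (t i))\<bar> \<le> e * card I"
    by (rule Asp_almost_invariant_averages[OF *])
  define m where "m = (\<lambda>f :: 'g \<Rightarrow> real. (\<Sum>i\<in>I. f (t i)) / card I)"
  have "sup_mean_on Asp m"
    unfolding m_def by (rule sup_mean_on_average[OF I]) (simp add: Asp_def)
  moreover have "\<bar>m (left_translate g f) - m f\<bar> \<le> e" if "f \<in> \<Phi>" "g \<in> K" for f g
  proof -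
    have c: "real (card I) > 0" using I by (simp add: card_gt_0_iff)
    have "m (left_translate g f) - m f = ((\<Sum>i\<in>I. f (g + t i)) - (\<Sum>i\<in>I. f (t i))) / card I"
      by (simp add: m_def left_translate_def diff_divide_distrib)
    then show ?thesis using t that c by (simp add: abs_divide divide_le_eq)
  qed
  ultimately show "\<exists>m. sup_mean_on Asp m \<and> (\<forall>f\<in>\<Phi>. \<forall>g\<in>K. \<bar>m (left_translate g f) - m f\<bar> \<le> e)"
    by blast
qed

end
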